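(* Let $T,S$ be commuting invertible measure-preserving transformations of a probability space $(\Omega,\mathcal F,\mu)$ and let $F\in L^2(\mu)$ be real-valued and such that the process $(F\circ T^m\circ S^n)_{(m,n)\in\mathbb Z^2}$ is absolutely continuous. Let $f$ be the density of the law of $F$ on $\mathbb R$; for $n\ge1$ let $\mu_n$ be the law on $\mathbb R^{n^2}$ of $(F\circ T^i\circ S^j)_{0\le i,j\le n-1}$ and let $\pi_n$ be the product probability measure on $\mathbb R^{n^2}$ all of whose one-dimensional marginals have density $f$. Then $$\lim_n\frac1{n^2}H_n^{(2)}=-\sup_n\frac1{n^2}H_{\pi_n}(\mu_n)-\int_{\mathbb R}f(t)\log f(t)\,dt .$$
   Context: A process $(X_g)_{g\in\mathbb Z^2}$ is absolutely continuous if for every finite $K\subset\mathbb Z^2$ the joint law of $(X_g)_{g\in K}$ is absolutely continuous with respect to $|K|$-dimensional Lebesgue measure. If $f_{n^2}$ denotes the density of $\mu_n$ with respect to $n^2$-dimensional Lebesgue measure, then $H_n^{(2)}:=-\int\log f_{n^2}\,d\mu_n\in[-\infty,\infty)$. For probability measures $P,Q$ on the same measurable space, $H_Q(P):=\sup_\Pi\sum_{E\in\Pi}P(E)\log\frac{P(E)}{Q(E)}$, the supremum over finite measurable partitions $\Pi$ (relative entropy, in $[0,\infty]$). *)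

theory Defs
  imports "HOL-Probability.Probability"
begin

definition invertible_mpt :: "'a measure \<Rightarrow> ('a \<Rightarrow> 'a) \<Rightarrow> bool" where
  "invertible_mpt M T \<longleftrightarrow>
     T \<in> measurable M M \<and> distr M M T = M \<and>
     bij_betw T (space M) (space M) \<and> inv_into (space M) T \<in> measurable M M"

definition int_iter :: "'a set \<Rightarrow> ('a \<Rightarrow> 'a) \<Rightarrow> int \<Rightarrow> 'a \<Rightarrow> 'a" where
  "int_iter A T k = (if 0 \<le> k then T ^^ nat k else inv_into A T ^^ nat (- k))"

definition orbit_process ::
  "'a measure \<Rightarrow> ('a \<Rightarrow> 'a) \<Rightarrow> ('a \<Rightarrow> 'a) \<Rightarrow> ('a \<Rightarrow> real) \<Rightarrow> int \<times> int \<Rightarrow> 'a \<Rightarrow> real" where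
  "orbit_process M T S F g =
     F \<circ> int_iter (space M) T (fst g) \<circ> int_iter (space M) S (snd g)"

definition joint_law ::
  "'a measure \<Rightarrow> ('i \<Rightarrow> 'a \<Rightarrow> real) \<Rightarrow> 'i set \<Rightarrow> ('i \<Rightarrow> real) measure" where
  "joint_law M X K = distr M (PiM K (\<lambda>_. lborel)) (\<lambda>\<omega>. \<lambda>k\<in>K. X k \<omega>)"

definition abs_cont_process :: "'a measure \<Rightarrow> ('i \<Rightarrow> 'a \<Rightarrow> real) \<Rightarrow> bool" where
  "abs_cont_process M X \<longleftrightarrow>
     (\<forall>K. finite K \<longrightarrow> absolutely_continuous (PiM K (\<lambda>_. lborel)) (joint_law M X K))"

definition grid :: "nat \<Rightarrow> (int \<times> int) set" where
  "grid n = {0..<int n} \<times> {0..<int n}"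

text \<open>
  The integral of a real function with values in the extended reals: positive part minus
  negative part. It is meaningful when at least one of the two parts is finite; if both are
  infinite, the subtraction of extended reals yields the junk value \<open>\<infinity>\<close>.
\<close>
definition ext_integral :: "'a measure \<Rightarrow> ('a \<Rightarrow> real) \<Rightarrow> ereal" where
  "ext_integral M g =
     enn2ereal (\<integral>\<^sup>+ x. ennreal (g x) \<partial>M) - enn2ereal (\<integral>\<^sup>+ x. ennreal (- g x) \<partial>M)"

text \<open>
  Differential entropy of \<open>N\<close> with respect to the reference measure \<open>L\<close>. The density is the
  Radon-Nikodym derivative; the points where it is \<open>0\<close> or \<open>\<infinity>\<close>, at which the value of the
  real logarithm is junk, form an \<open>N\<close>-null set.
\<close>
definition diff_entropy :: "'b measure \<Rightarrow> 'b measure \<Rightarrow> ereal" where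
  "diff_entropy L N = - ext_integral N (\<lambda>x. ln (enn2real (RN_deriv L N x)))"

text \<open>The conventions \<open>0 log (0/q) = 0\<close> for all \<open>q\<close> and \<open>p log (p/0) = \<infinity>\<close> for \<open>p > 0\<close>.\<close>
definition rel_entropy_term :: "real \<Rightarrow> real \<Rightarrow> ereal" where
  "rel_entropy_term p q =
     (if p = 0 then 0 else if q = 0 then \<infinity> else ereal (p * ln (p / q)))"

text \<open>\<open>rel_entropy Q P\<close> is \<open>H\<^sub>Q(P)\<close>: the reference measure comes first.\<close>
definition rel_entropy :: "'b measure \<Rightarrow> 'b measure \<Rightarrow> ereal" where
  "rel_entropy Q P =
     (SUP \<P> \<in> {\<P>. finite \<P> \<and> \<P> \<subseteq> sets Q \<and> partition_on (space Q) \<P>}.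
        \<Sum>E\<in>\<P>. rel_entropy_term (measure P E) (measure Q E))"

end

theory Submission
  imports Defs
begin

text \<open>
  If \<open>\<phi>\<close> is the density of \<open>P\<close> with respect to \<open>Q\<close>, the supremum over partitions equals
  the integral of \<open>\<phi> ln \<phi> - \<phi> + 1\<close> under \<open>Q\<close>, whose integrand is nonnegative: one
  inequality holds because this convex function lies above its tangents, the other by Fatou's
  lemma along simple functions approximating \<open>\<phi>\<close> from the side of \<open>1\<close>. The same tangents
  give the variational formula with test functions \<open>\<integral>\<psi> dP - ln \<integral>exp \<psi> dQ\<close>. Copying a test
  function for the \<open>m \<times> m\<close> square to the \<open>(n div m)\<^sup>2\<close> disjoint translates of that square inside
  the \<open>n \<times> n\<close> square, which are independent under \<open>\<pi>\<^sub>n\<close> and equally distributed under \<open>\<mu>\<^sub>n\<close>,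
  shows that the relative entropies \<open>K\<^sub>n\<close> satisfy \<open>(n div m)\<^sup>2 K\<^sub>m \<le> K\<^sub>n\<close>; hence \<open>K\<^sub>n / n\<^sup>2\<close>
  converges to its supremum. Finally the entropy of \<open>\<mu>\<^sub>n\<close> is \<open>- K\<^sub>n - n\<^sup>2 \<integral>f ln f\<close>, even if terms
  are infinite, since the finite second moment bounds the negative part of \<open>f ln f\<close>.
\<close>


section \<open>The convex function \<open>x ln x - x + 1\<close> and its tangents\<close>

text \<open>For a probability density with respect to a probability measure the affine correction
  \<open>- x + 1\<close> integrates to zero, so it leaves the relative entropy unchanged and makes
  the integrand nonnegative. The value at \<open>0\<close> is \<open>1\<close>, the limit from the
  right.\<close>

definition entropy_fun :: "real \<Rightarrow> real" where
  "entropy_fun x = x * ln x - x + 1"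

lemma entropy_fun_measurable [measurable]: "entropy_fun \<in> borel_measurable borel"
  unfolding entropy_fun_def by measurable

text \<open>The left side is the tangent at \<open>c\<close>, of slope \<open>ln c\<close>,
  evaluated at \<open>x\<close>. For positive \<open>x\<close> the claim is
  \<open>ln y \<le> y - 1\<close> at \<open>y = c / x\<close>, multiplied by
  \<open>x\<close>.\<close>

lemma entropy_fun_ge_tangent:
  assumes "0 \<le> x" "0 < c"
  shows "x * ln c - c + 1 \<le> entropy_fun x"
proof (cases "x = 0")
  case False
  with assms have x: "x > 0" by simp
  have "x * (ln c - ln x) = x * ln (c / x)"
    using x assms by (simp add: ln_div)
  also have "\<dots> \<le> x * (c / x - 1)"
    using x assms by (intro mult_left_mono ln_le_minus_one) auto
  also have "\<dots> = c - x" using x by (simp add: field_simps)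
  finally show ?thesis by (simp add: entropy_fun_def algebra_simps)
qed (use assms in \<open>simp add: entropy_fun_def\<close>)

lemma entropy_fun_nonneg: "0 \<le> x \<Longrightarrow> 0 \<le> entropy_fun x"
  using entropy_fun_ge_tangent[of x 1] by simp

section \<open>Integrals with values in the extended reals\<close>

lemma ext_integral_cong_AE:
  assumes "AE x in N. a x = b x"
  shows "ext_integral N a = ext_integral N b"
proof -
  have "(\<integral>\<^sup>+ x. ennreal (a x) \<partial>N) = (\<integral>\<^sup>+ x. ennreal (b x) \<partial>N)"
    by (rule nn_integral_cong_AE) (use assms in auto)
  moreover have "(\<integral>\<^sup>+ x. ennreal (- a x) \<partial>N) = (\<integral>\<^sup>+ x. ennreal (- b x) \<partial>N)"
    by (rule nn_integral_cong_AE) (use assms in auto)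
  ultimately show ?thesis by (simp add: ext_integral_def)
qed

lemma ext_integral_nonneg:
  assumes "\<And>x. x \<in> space N \<Longrightarrow> 0 \<le> a x"
  shows "ext_integral N a = enn2ereal (\<integral>\<^sup>+ x. ennreal (a x) \<partial>N)"
proof -
  have "(\<integral>\<^sup>+ x. ennreal (- a x) \<partial>N) = (\<integral>\<^sup>+ x. 0 \<partial>N)"
    by (rule nn_integral_cong) (use assms in \<open>auto simp: ennreal_neg\<close>)
  then show ?thesis by (simp add: ext_integral_def zero_ennreal.rep_eq)
qed

lemma ext_integral_integrable:
  assumes "integrable N a"
  shows "ext_integral N a = ereal (integral\<^sup>L N a)"
proof -
  have "(\<integral>\<^sup>+ x. ennreal (a x) \<partial>N) < \<infinity>" "(\<integral>\<^sup>+ x. ennreal (- a x) \<partial>N) < \<infinity>"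
    using assms by (auto simp: real_integrable_def top.not_eq_extremum)
  then show ?thesis
    unfolding ext_integral_def real_lebesgue_integral_def[OF assms]
    by (cases "\<integral>\<^sup>+ x. ennreal (a x) \<partial>N"; cases "\<integral>\<^sup>+ x. ennreal (- a x) \<partial>N") 
       (auto simp: enn2ereal_ennreal)
qed

lemma nn_integral_neg_add_less_top:
  assumes [measurable]: "a \<in> borel_measurable N" "b \<in> borel_measurable N"
    and a: "(\<integral>\<^sup>+ x. ennreal (- a x) \<partial>N) < \<infinity>" and b: "(\<integral>\<^sup>+ x. ennreal (- b x) \<partial>N) < \<infinity>"
  shows "(\<integral>\<^sup>+ x. ennreal (- (a x + b x)) \<partial>N) < \<infinity>"
proof -
  have "ennreal (- (a x + b x)) \<le> ennreal (- a x) + ennreal (- b x)" for x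
    by (smt (verit) ennreal_leI ennreal_neg ennreal_plus add_0 add.right_neutral le_cases)
  then have "(\<integral>\<^sup>+ x. ennreal (- (a x + b x)) \<partial>N)
      \<le> (\<integral>\<^sup>+ x. ennreal (- a x) + ennreal (- b x) \<partial>N)"
    by (intro nn_integral_mono) auto
  also have "\<dots> = (\<integral>\<^sup>+ x. ennreal (- a x) \<partial>N) + (\<integral>\<^sup>+ x. ennreal (- b x) \<partial>N)"
    by (rule nn_integral_add) auto
  also have "\<dots> < \<infinity>" using a b by (simp add: ennreal_add_less_top)
  finally show ?thesis .
qed

text \<open>Pointwise, the positive part of \<open>a + b\<close> plus the negative parts of
  \<open>a\<close> and \<open>b\<close> equals the negative part of \<open>a + b\<close> plus the
  positive parts of \<open>a\<close> and \<open>b\<close>. After integration the three negative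
  parts are finite and can be subtracted, even if the positive parts have infinite
  integrals.\<close>

lemma ext_integral_add:
  assumes [measurable]: "a \<in> borel_measurable N" "b \<in> borel_measurable N"
    and a: "(\<integral>\<^sup>+ x. ennreal (- a x) \<partial>N) < \<infinity>" and b: "(\<integral>\<^sup>+ x. ennreal (- b x) \<partial>N) < \<infinity>"
  shows "ext_integral N (\<lambda>x. a x + b x) = ext_integral N a + ext_integral N b"
proof -
  have pt: "ennreal (a x + b x) + (ennreal (- a x) + ennreal (- b x))
      = ennreal (- (a x + b x)) + (ennreal (a x) + ennreal (b x))" for x
    by (cases "0 \<le> a x"; cases "0 \<le> b x"; cases "0 \<le> a x + b x")
       (simp_all add: ennreal_neg flip: ennreal_plus)
  let ?i = "\<lambda>g. \<integral>\<^sup>+ x. ennreal (g x) \<partial>N"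
  have "?i (\<lambda>x. a x + b x) + (?i (\<lambda>x. - a x) + ?i (\<lambda>x. - b x))
      = (\<integral>\<^sup>+ x. ennreal (a x + b x) + (ennreal (- a x) + ennreal (- b x)) \<partial>N)"
    by (simp add: nn_integral_add)
  also have "\<dots> = (\<integral>\<^sup>+ x. ennreal (- (a x + b x)) + (ennreal (a x) + ennreal (b x)) \<partial>N)"
    by (simp only: pt)
  also have "\<dots> = ?i (\<lambda>x. - (a x + b x)) + (?i a + ?i b)"
    by (simp add: nn_integral_add)
  finally have eq: "?i (\<lambda>x. a x + b x) + (?i (\<lambda>x. - a x) + ?i (\<lambda>x. - b x))
      = ?i (\<lambda>x. - (a x + b x)) + (?i a + ?i b)" .
  have ar: "enn2ereal s - enn2ereal t = (enn2ereal p - enn2ereal n) + (enn2ereal q - enn2ereal m)"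
    if "s + (n + m) = t + (p + q)" "n < \<infinity>" "m < \<infinity>" "t < \<infinity>" for s t n m p q :: ennreal
    using that
    by (cases s; cases t; cases n; cases m; cases p; cases q)
       (auto simp: enn2ereal_ennreal simp flip: ennreal_plus)
  show ?thesis
    unfolding ext_integral_def
    using ar[OF eq] a b nn_integral_neg_add_less_top[OF assms] by simp
qed

lemma ext_integral_neq_MInf:
  assumes "(\<integral>\<^sup>+ x. ennreal (- a x) \<partial>N) < \<infinity>"
  shows "ext_integral N a \<noteq> - \<infinity>"
  using assms unfolding ext_integral_def
  by (cases "\<integral>\<^sup>+ x. ennreal (a x) \<partial>N"; cases "\<integral>\<^sup>+ x. ennreal (- a x) \<partial>N")
     (auto simp: enn2ereal_ennreal)

text \<open>The finiteness of the negative part belongs to the claim because the induction step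
  needs it to apply additivity of two summands.\<close>

lemma ext_integral_sum:
  assumes "finite I"
    and [measurable]: "\<And>i. i \<in> I \<Longrightarrow> a i \<in> borel_measurable N"
    and "\<And>i. i \<in> I \<Longrightarrow> (\<integral>\<^sup>+ x. ennreal (- a i x) \<partial>N) < \<infinity>"
  shows "ext_integral N (\<lambda>x. \<Sum>i\<in>I. a i x) = (\<Sum>i\<in>I. ext_integral N (a i)) \<and>
    (\<integral>\<^sup>+ x. ennreal (- (\<Sum>i\<in>I. a i x)) \<partial>N) < \<infinity>"
  using assms
proof (induction I)
  case empty
  show ?case by (simp add: ext_integral_def)
next
  case (insert i I)
  have [measurable]: "a j \<in> borel_measurable N" if "j \<in> I" for j using insert.prems that by auto
  have [measurable]: "a i \<in> borel_measurable N" using insert.prems by auto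
  have "(\<lambda>x. \<Sum>i\<in>I. a i x) \<in> borel_measurable N" by measurable
  with insert show ?case
    using ext_integral_add[of "a i" N "\<lambda>x. \<Sum>i\<in>I. a i x"]
      nn_integral_neg_add_less_top[of "a i" N "\<lambda>x. \<Sum>i\<in>I. a i x"]
    by simp
qed

lemma ext_integral_distr:
  assumes [measurable]: "X \<in> measurable M N" "a \<in> borel_measurable N"
  shows "ext_integral (distr M N X) a = ext_integral M (\<lambda>x. a (X x))"
  unfolding ext_integral_def by (simp add: nn_integral_distr)

lemma ext_integral_density:
  assumes [measurable]: "a \<in> borel_measurable N" "f \<in> borel_measurable N"
    and f: "\<And>x. x \<in> space N \<Longrightarrow> 0 \<le> f x"
  shows "ext_integral (density N (\<lambda>x. ennreal (f x))) a = ext_integral N (\<lambda>x. f x * a x)"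
proof -
  have "(\<integral>\<^sup>+ x. ennreal (g x) \<partial>density N (\<lambda>x. ennreal (f x))) = (\<integral>\<^sup>+ x. ennreal (f x * g x) \<partial>N)"
    if [measurable]: "g \<in> borel_measurable N" for g
    by (subst nn_integral_density) (auto intro!: nn_integral_cong simp: f ennreal_mult')
  from this[of a] this[of "\<lambda>x. - a x"] show ?thesis by (simp add: ext_integral_def)
qed

section \<open>Simple functions\<close>

lemma (in finite_measure) integrable_simple_function:
  fixes \<psi> :: "'a \<Rightarrow> real"
  assumes "simple_function M \<psi>"
  shows "integrable M \<psi>"
proof (rule integrable_const_bound)
  show "AE x in M. norm (\<psi> x) \<le> Max ((\<lambda>x. \<bar>\<psi> x\<bar>) ` space M)"
  proof (rule AE_I2)
    fix x assume "x \<in> space M"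
    moreover have "finite ((\<lambda>x. \<bar>\<psi> x\<bar>) ` space M)"
      using finite_imageI[OF simple_functionD(1)[OF assms], of abs] by (simp add: image_comp comp_def)
    ultimately show "norm (\<psi> x) \<le> Max ((\<lambda>x. \<bar>\<psi> x\<bar>) ` space M)"
      by auto
  qed
qed (use assms in \<open>simp add: borel_measurable_simple_function\<close>)

lemma simple_function_sequence_to_real:
  fixes u :: "'a \<Rightarrow> real"
  assumes "u \<in> borel_measurable N" "\<And>x. 0 \<le> u x"
  obtains s where "\<And>j. simple_function N (s j)" "\<And>j x. 0 \<le> s j x" "\<And>j x. s j x \<le> u x"
    "\<And>x. (\<lambda>j. s j x) \<longlonglongrightarrow> u x"
proof -
  obtain s where s: "incseq s" "\<And>j. simple_function N (s j)" "\<And>x. bdd_above (range (\<lambda>j. s j x))"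
    "\<And>j x. 0 \<le> s j x" "u = (SUP j. s j)"
    using borel_measurable_implies_simple_function_sequence_real[OF assms] by blast
  have u: "u x = (SUP j. s j x)" for x
    unfolding s(5) by (simp add: image_comp)
  have "s j x \<le> u x" for j x
    unfolding u by (rule cSUP_upper) (use s in auto)
  moreover have "(\<lambda>j. s j x) \<longlonglongrightarrow> u x" for x
    unfolding u by (rule LIMSEQ_incseq_SUP) (use s in \<open>auto simp: incseq_def le_fun_def\<close>)
  ultimately show ?thesis using that s by blast
qed

section \<open>Relative entropy as an integral\<close>

text \<open>The density is real and nonnegative everywhere, not just almost everywhere, so the
  pointwise inequalities for \<open>entropy_fun\<close> apply without exceptional sets.\<close>

locale density_pair = prob_space Q for Q :: "'b measure" +
  fixes \<phi> :: "'b \<Rightarrow> real"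
  assumes \<phi>_measurable [measurable]: "\<phi> \<in> borel_measurable Q"
    and \<phi>_nonneg: "0 \<le> \<phi> x"
    and prob_space_density: "prob_space (density Q (\<lambda>x. ennreal (\<phi> x)))"
begin

abbreviation P :: "'b measure" where
  "P \<equiv> density Q (\<lambda>x. ennreal (\<phi> x))"

definition kl :: ennreal where
  "kl = (\<integral>\<^sup>+ x. ennreal (entropy_fun (\<phi> x)) \<partial>Q)"

sublocale P: prob_space P
  by (rule prob_space_density)

lemma nn_integral_\<phi>: "(\<integral>\<^sup>+ x. ennreal (\<phi> x) \<partial>Q) = 1"
proof -
  have "(\<integral>\<^sup>+ x. ennreal (\<phi> x) \<partial>Q) = emeasure P (space P)"
    by (simp add: emeasure_density cong: nn_integral_cong)
  then show ?thesis using P.emeasure_space_1 by simp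
qed

lemma integrable_\<phi>: "integrable Q \<phi>"
  using nn_integral_\<phi> by (intro integrableI_nonneg) (auto simp: \<phi>_nonneg)

lemma integral_\<phi>: "(\<integral>x. \<phi> x \<partial>Q) = 1"
  using nn_integral_\<phi> by (simp add: integral_eq_nn_integral \<phi>_nonneg)

text \<open>Passing from \<open>P\<close> to \<open>Q\<close> turns \<open>ln \<phi>\<close> into
  \<open>\<phi> ln \<phi>\<close>, which is \<open>entropy_fun \<phi>\<close> plus
  \<open>\<phi> - 1\<close>. The first summand is nonnegative and the second is integrable with
  integral zero, so additivity applies even when \<open>kl\<close> is infinite.\<close>

lemma ext_integral_ln_density: "ext_integral P (\<lambda>x. ln (\<phi> x)) = enn2ereal kl"
  and nn_integral_neg_ln_density: "(\<integral>\<^sup>+ x. ennreal (- ln (\<phi> x)) \<partial>P) < \<infinity>"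
proof -
  have eq: "\<phi> x * ln (\<phi> x) = entropy_fun (\<phi> x) + (\<phi> x - 1)" for x
    by (simp add: entropy_fun_def)
  have int: "integrable Q (\<lambda>x. \<phi> x - 1)" using integrable_\<phi> by simp
  have "(\<integral>\<^sup>+ x. ennreal (- (\<phi> x - 1)) \<partial>Q) < \<infinity>"
    using int by (auto simp: real_integrable_def top.not_eq_extremum)
  moreover have "(\<integral>\<^sup>+ x. ennreal (- entropy_fun (\<phi> x)) \<partial>Q) < \<infinity>"
    using entropy_fun_nonneg[OF \<phi>_nonneg] by (simp add: ennreal_neg)
  ultimately have sum: "ext_integral Q (\<lambda>x. entropy_fun (\<phi> x) + (\<phi> x - 1)) =
      ext_integral Q (\<lambda>x. entropy_fun (\<phi> x)) + ext_integral Q (\<lambda>x. \<phi> x - 1)"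
    "(\<integral>\<^sup>+ x. ennreal (- (entropy_fun (\<phi> x) + (\<phi> x - 1))) \<partial>Q) < \<infinity>"
    by (intro ext_integral_add nn_integral_neg_add_less_top; simp)+
  have "ext_integral P (\<lambda>x. ln (\<phi> x)) = ext_integral Q (\<lambda>x. \<phi> x * ln (\<phi> x))"
    by (rule ext_integral_density) (auto simp: \<phi>_nonneg)
  also have "\<dots> = enn2ereal kl"
    unfolding eq sum(1) kl_def ext_integral_integrable[OF int]
    using integrable_\<phi> by (simp add: ext_integral_nonneg entropy_fun_nonneg \<phi>_nonneg integral_\<phi> prob_space)
  finally show "ext_integral P (\<lambda>x. ln (\<phi> x)) = enn2ereal kl" .
  have "(\<integral>\<^sup>+ x. ennreal (- ln (\<phi> x)) \<partial>P) = (\<integral>\<^sup>+ x. ennreal (- (\<phi> x * ln (\<phi> x))) \<partial>Q)"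
    by (subst nn_integral_density) (auto intro!: nn_integral_cong simp: \<phi>_nonneg simp flip: ennreal_mult')
  with sum(2) show "(\<integral>\<^sup>+ x. ennreal (- ln (\<phi> x)) \<partial>P) < \<infinity>"
    by (simp only: eq)
qed

lemma integral_P:
  fixes h :: "'b \<Rightarrow> real"
  assumes [measurable]: "h \<in> borel_measurable Q"
  shows "(\<integral>x. h x \<partial>P) = (\<integral>x. \<phi> x * h x \<partial>Q)"
  by (subst integral_real_density) (auto simp: \<phi>_nonneg)

lemma integrable_P:
  fixes h :: "'b \<Rightarrow> real"
  assumes [measurable]: "h \<in> borel_measurable Q"
  shows "integrable P h \<longleftrightarrow> integrable Q (\<lambda>x. \<phi> x * h x)"
  by (subst integrable_real_density) (auto simp: \<phi>_nonneg)

text \<open>The point of tangency may vary with \<open>x\<close>: this is the tangent inequality at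
  \<open>c x\<close>, integrated over \<open>Q\<close>.\<close>

lemma tangent_le_kl:
  assumes c [measurable]: "c \<in> borel_measurable Q" and "\<And>x. x \<in> space Q \<Longrightarrow> 0 \<le> c x"
    and c0: "AE x in Q. c x = 0 \<longrightarrow> \<phi> x = 0"
    and "integrable Q c" "integrable P (\<lambda>x. ln (c x))"
  shows "ereal ((\<integral>x. ln (c x) \<partial>P) - (\<integral>x. c x \<partial>Q) + 1) \<le> enn2ereal kl"
proof (cases "kl = \<infinity>")
  case False
  have int: "integrable Q (\<lambda>x. \<phi> x * ln (c x) - c x + 1)"
    using assms by (auto simp: integrable_P)
  have int': "integrable Q (\<lambda>x. entropy_fun (\<phi> x))"
    using False by (intro integrableI_nonneg) 
      (auto simp: kl_def entropy_fun_nonneg \<phi>_nonneg top.not_eq_extremum)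
  have "(\<integral>x. ln (c x) \<partial>P) - (\<integral>x. c x \<partial>Q) + 1 = (\<integral>x. \<phi> x * ln (c x) - c x + 1 \<partial>Q)"
    using assms int by (simp add: integral_P integrable_P prob_space)
  also have "\<dots> \<le> (\<integral>x. entropy_fun (\<phi> x) \<partial>Q)"
  proof (rule integral_mono_AE[OF int int'])
    show "AE x in Q. \<phi> x * ln (c x) - c x + 1 \<le> entropy_fun (\<phi> x)"
      using c0
    proof (rule AE_mp, intro AE_I2 impI)
      fix x assume x: "x \<in> space Q" "c x = 0 \<longrightarrow> \<phi> x = 0"
      \<comment> \<open>There is no tangent at \<open>c x = 0\<close>, but then
        \<open>\<phi> x\<close> vanishes too and both sides equal \<open>1\<close>.\<close>
      show "\<phi> x * ln (c x) - c x + 1 \<le> entropy_fun (\<phi> x)"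
        using x assms(2)[OF x(1)] entropy_fun_ge_tangent[OF \<phi>_nonneg, of "c x" x]
        by (cases "c x = 0") (auto simp: entropy_fun_def)
    qed
  qed
  finally show ?thesis
    unfolding kl_def by (subst nn_integral_eq_integral[OF int'])
      (auto simp: entropy_fun_nonneg \<phi>_nonneg enn2ereal_ennreal integral_nonneg_AE)
qed simp

text \<open>The witness is \<open>\<psi> = ln (c j)\<close> with \<open>c j\<close> simple, positive
  and converging to \<open>\<phi>\<close>. Choosing \<open>c j\<close> between \<open>1\<close> and
  \<open>\<phi>\<close> keeps the tangent value \<open>u j\<close> nonnegative, so Fatou's lemma
  applies even when \<open>kl\<close> is infinite.\<close>

lemma ex_simple_function_less_kl:
  assumes "ereal r < enn2ereal kl"
  obtains \<psi> where "simple_function Q \<psi>" "r < (\<integral>x. \<psi> x \<partial>P) - (\<integral>x. exp (\<psi> x) \<partial>Q) + 1"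
proof -
  obtain s where s: "\<And>j. simple_function Q (s j)" "\<And>j x. 0 \<le> s j x"
    "\<And>j x. s j x \<le> max 0 (\<phi> x - 1)" "\<And>x. (\<lambda>j. s j x) \<longlonglongrightarrow> max 0 (\<phi> x - 1)"
    by (rule simple_function_sequence_to_real[of "\<lambda>x. max 0 (\<phi> x - 1)" Q]) auto
  obtain t where t: "\<And>j. simple_function Q (t j)" "\<And>j x. 0 \<le> t j x"
    "\<And>j x. t j x \<le> max 0 (1 - \<phi> x)" "\<And>x. (\<lambda>j. t j x) \<longlonglongrightarrow> max 0 (1 - \<phi> x)"
    by (rule simple_function_sequence_to_real[of "\<lambda>x. max 0 (1 - \<phi> x)" Q]) auto
  \<comment> \<open>\<open>c j x\<close> lies between \<open>1\<close> and \<open>\<phi> x\<close>, except that it is kept away from \<open>0\<close>.\<close>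
  define c where "c j x = 1 + s j x - min (t j x) (1 - 1 / real (j + 2))" for j x
  have simple: "simple_function Q (c j)" for j
    unfolding c_def using s(1) t(1)
    by (intro simple_function_diff simple_function_add simple_function_const
        simple_function_compose2[where h = min]) auto
  then have c_meas [measurable]: "c j \<in> borel_measurable Q" for j
    by (rule borel_measurable_simple_function)
  have pos: "0 < c j x" for j x
  proof -
    have "min (t j x) (1 - 1 / real (j + 2)) < 1" by (simp add: min_less_iff_disj)
    then show ?thesis using s(2)[of j x] by (simp add: c_def)
  qed
  have lim: "(\<lambda>j. c j x) \<longlonglongrightarrow> \<phi> x" for x
  proof -
    have "(\<lambda>j. 1 / real (j + 2)) \<longlonglongrightarrow> 0"
      using LIMSEQ_ignore_initial_segment[OF lim_1_over_n, of 2] by simp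
    then have "(\<lambda>j. c j x) \<longlonglongrightarrow> 1 + max 0 (\<phi> x - 1) - min (max 0 (1 - \<phi> x)) (1 - 0)"
      unfolding c_def by (intro tendsto_intros s(4) t(4))
    also have "1 + max 0 (\<phi> x - 1) - min (max 0 (1 - \<phi> x)) (1 - 0) = \<phi> x"
      using \<phi>_nonneg[of x] by (auto simp: max_def min_def)
    finally show ?thesis .
  qed
  define u where "u j x = \<phi> x * ln (c j x) - c j x + 1" for j x
  \<comment> \<open>\<open>u j x\<close> equals \<open>entropy_fun (c j x)\<close> plus
    \<open>(\<phi> x - c j x) * ln (c j x)\<close>, and the last two factors have the same sign
    because \<open>c j x\<close> lies between \<open>1\<close> and \<open>\<phi> x\<close>.\<close>
  have u_nonneg: "0 \<le> u j x" for j x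
  proof (cases "1 \<le> \<phi> x")
    case True
    then have "t j x = 0" using t(2,3)[of j x] by simp
    then have c1: "1 \<le> c j x" "c j x \<le> \<phi> x"
      using s(2,3)[of j x] True by (auto simp: c_def)
    have "c j x * ln (c j x) \<le> \<phi> x * ln (c j x)"
      using c1 by (intro mult_right_mono) auto
    moreover have "0 \<le> entropy_fun (c j x)" using c1 by (intro entropy_fun_nonneg) auto
    ultimately show ?thesis by (simp add: u_def entropy_fun_def)
  next
    case False
    then have s0: "s j x = 0" using s(2,3)[of j x] by simp
    have c1: "c j x \<le> 1" using t(2)[of j x] by (simp add: c_def s0)
    have c2: "\<phi> x \<le> c j x" using t(3)[of j x] False by (simp add: c_def s0)
    have "c j x * ln (c j x) \<le> \<phi> x * ln (c j x)"
      using c1 c2 pos[of j x] by (intro mult_right_mono_neg) auto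
    moreover have "0 \<le> entropy_fun (c j x)" using pos[of j x] by (intro entropy_fun_nonneg) auto
    ultimately show ?thesis by (simp add: u_def entropy_fun_def)
  qed
  \<comment> \<open>At \<open>\<phi> x = 0\<close> the logarithm diverges, but its factor is exactly
    \<open>0\<close> for every \<open>j\<close>, so only \<open>1 - c j x\<close> remains.\<close>
  have u_lim: "(\<lambda>j. u j x) \<longlonglongrightarrow> entropy_fun (\<phi> x)" for x
  proof (cases "\<phi> x = 0")
    case True
    then show ?thesis
      using tendsto_add[OF tendsto_minus[OF lim[of x]] tendsto_const[of 1]] by (simp add: u_def entropy_fun_def)
  next
    case False
    then show ?thesis unfolding u_def entropy_fun_def
      using \<phi>_nonneg[of x] by (intro tendsto_intros lim) auto
  qed
  have "kl = (\<integral>\<^sup>+ x. liminf (\<lambda>j. ennreal (u j x)) \<partial>Q)"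
    unfolding kl_def by (intro nn_integral_cong lim_imp_Liminf[symmetric] tendsto_ennrealI u_lim) simp
  also have "\<dots> \<le> liminf (\<lambda>j. \<integral>\<^sup>+ x. ennreal (u j x) \<partial>Q)"
    by (rule nn_integral_liminf) (simp add: u_def)
  finally have fatou: "kl \<le> liminf (\<lambda>j. \<integral>\<^sup>+ x. ennreal (u j x) \<partial>Q)" .
  obtain j where j: "ereal r < enn2ereal (\<integral>\<^sup>+ x. ennreal (u j x) \<partial>Q)"
  proof (rule ccontr)
    assume "\<not> thesis"
    then have le: "enn2ereal (\<integral>\<^sup>+ x. ennreal (u j x) \<partial>Q) \<le> ereal r" for j
      using that by (meson not_le)
    then have "0 \<le> r" using order_trans[OF enn2ereal_nonneg le[of 0]] by simp
    then have "(\<integral>\<^sup>+ x. ennreal (u j x) \<partial>Q) \<le> ennreal r" for j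
      using le[of j] by (simp add: less_eq_ennreal.rep_eq enn2ereal_ennreal)
    then have "liminf (\<lambda>j. \<integral>\<^sup>+ x. ennreal (u j x) \<partial>Q) \<le> ennreal r"
      by (intro Liminf_le) auto
    with fatou have "enn2ereal kl \<le> ereal r"
      using \<open>0 \<le> r\<close> by (metis enn2ereal_ennreal less_eq_ennreal.rep_eq order_trans)
    with assms show False by simp
  qed
  have simple_ln: "simple_function Q (\<lambda>x. ln (c j x))"
    using simple_function_compose1[OF simple, of ln] .
  have simple_P: "simple_function P (\<lambda>x. ln (c j x))"
    using simple_ln by (simp add: simple_function_def)
  have int1: "integrable P (\<lambda>x. ln (c j x))"
    by (rule P.integrable_simple_function[OF simple_P])
  have int2: "integrable Q (c j)"
    by (rule integrable_simple_function[OF simple])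
  have int3: "integrable Q (\<lambda>x. \<phi> x * ln (c j x))"
    using int1 by (simp add: integrable_P)
  have "(\<integral>\<^sup>+ x. ennreal (u j x) \<partial>Q) = ennreal (\<integral>x. u j x \<partial>Q)"
    unfolding u_def using int2 int3 u_nonneg
    by (intro nn_integral_eq_integral) (auto simp: u_def)
  moreover have "0 \<le> (\<integral>x. u j x \<partial>Q)" using u_nonneg by simp
  ultimately have "r < (\<integral>x. u j x \<partial>Q)" using j by (simp add: enn2ereal_ennreal)
  also have "\<dots> = (\<integral>x. ln (c j x) \<partial>P) - (\<integral>x. exp (ln (c j x)) \<partial>Q) + 1"
    unfolding u_def using int2 int3 pos by (simp add: integral_P prob_space)
  finally show ?thesis using that[OF simple_ln] by simp
qed

lemma measure_P_eq_0: "E \<in> sets Q \<Longrightarrow> measure Q E = 0 \<Longrightarrow> measure P E = 0"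
  using absolutely_continuousD[OF absolutely_continuousI_density, of "\<lambda>x. ennreal (\<phi> x)" Q E]
  by (simp add: P.emeasure_eq_measure emeasure_eq_measure)

text \<open>For a given partition, the tangent bound is applied to the conditional expectation
  \<open>c\<close> of \<open>\<phi>\<close> given the cells: its \<open>Q\<close>-integral is
  \<open>1\<close>, and the \<open>P\<close>-integral of its logarithm is the sum over the
  partition.\<close>

lemma rel_entropy_le_kl: "rel_entropy Q P \<le> enn2ereal kl"
  unfolding rel_entropy_def
proof (rule SUP_least, clarify)
  fix \<P> assume fin: "finite \<P>" and sub: "\<P> \<subseteq> sets Q" and part: "partition_on (space Q) \<P>"
  \<comment> \<open>A cell with \<open>measure Q E = 0\<close> gets the quotient \<open>0\<close>.
    This is harmless, since such a cell is also null for \<open>P\<close>.\<close>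
  define a where "a E = measure P E / measure Q E" for E
  define c where "c x = (\<Sum>E\<in>\<P>. a E * indicator E x)" for x
  have sum_ind: "(\<Sum>E\<in>\<P>. h E * indicator E x) = h E0" if "E0 \<in> \<P>" "x \<in> E0"
    for h :: "'b set \<Rightarrow> real" and E0 x
  proof -
    have "x \<notin> E" if "E \<in> \<P>" "E \<noteq> E0" for E
      using that \<open>E0 \<in> \<P>\<close> \<open>x \<in> E0\<close> partition_onD2[OF part] by (auto dest: disjointD)
    then have "(\<Sum>E\<in>\<P>. h E * indicator E x) = (\<Sum>E\<in>{E0}. h E * indicator E x)"
      using \<open>E0 \<in> \<P>\<close> fin by (intro sum.mono_neutral_right) auto
    then show ?thesis using \<open>x \<in> E0\<close> by simp
  qed
  have ex: "\<exists>E\<in>\<P>. x \<in> E" if "x \<in> space Q" for x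
    using that partition_onD1[OF part] by auto
  have sets [measurable]: "E \<in> sets Q" if "E \<in> \<P>" for E using that sub by auto
  have c_meas [measurable]: "c \<in> borel_measurable Q" unfolding c_def by measurable
  have ln_c: "ln (c x) = (\<Sum>E\<in>\<P>. ln (a E) * indicator E x)" if "x \<in> space Q" for x
    using ex[OF that] sum_ind by (auto simp: c_def)
  have sumP: "(\<Sum>E\<in>\<P>. measure N E) = 1" if "prob_space N" "sets N = sets Q" for N
  proof -
    interpret N: prob_space N by fact
    have "(\<Sum>E\<in>\<P>. measure N E) = measure N (\<Union>E\<in>\<P>. E)"
      using fin sub partition_onD2[OF part] that(2)
      by (intro N.finite_measure_finite_Union[symmetric]) (auto simp: disjoint_family_on_def dest: disjointD)
    also have "\<dots> = 1" 
      using partition_onD1[OF part] N.prob_space sets_eq_imp_space_eq[OF that(2)] by simp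
    finally show ?thesis .
  qed
  have int_c: "(\<integral>x. c x \<partial>Q) = 1" "integrable Q c"
  proof -
    have "(\<integral>x. c x \<partial>Q) = (\<Sum>E\<in>\<P>. a E * measure Q E)"
      unfolding c_def by (subst Bochner_Integration.integral_sum) (auto simp: less_top[symmetric])
    also have "\<dots> = (\<Sum>E\<in>\<P>. measure P E)"
      using measure_P_eq_0[OF sets] by (intro sum.cong) (auto simp: a_def)
    also have "\<dots> = 1" by (rule sumP) (auto intro: prob_space_density)
    finally show "(\<integral>x. c x \<partial>Q) = 1" .
    show "integrable Q c"
      unfolding c_def by (intro Bochner_Integration.integrable_sum) (auto simp: less_top[symmetric])
  qed
  have int_ln: "integrable P (\<lambda>x. ln (c x))"
    by (subst Bochner_Integration.integrable_cong[OF refl ln_c])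
       (auto intro!: Bochner_Integration.integrable_sum simp: less_top[symmetric])
  \<comment> \<open>On a cell that is null for \<open>P\<close> the integral of the nonnegative
    \<open>\<phi>\<close> under \<open>Q\<close> is zero, so \<open>\<phi>\<close> vanishes there
    almost everywhere. These are the only cells on which \<open>c\<close> can vanish.\<close>
  have "AE x in Q. \<forall>E\<in>\<P>. measure P E = 0 \<longrightarrow> x \<in> E \<longrightarrow> \<phi> x = 0"
  proof (rule AE_finite_allI[OF fin])
    fix E assume "E \<in> \<P>"
    note [measurable] = sets[OF this]
    show "AE x in Q. measure P E = 0 \<longrightarrow> x \<in> E \<longrightarrow> \<phi> x = 0"
    proof (cases "measure P E = 0")
      case True
      then have "E \<in> null_sets P" using \<open>E \<in> \<P>\<close> sets
        by (auto simp: null_sets_def P.emeasure_eq_measure)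
      then show ?thesis by (subst (asm) null_sets_density_iff) (auto simp: \<phi>_nonneg ennreal_eq_0_iff order_antisym)
    qed auto
  qed
  then have c0: "AE x in Q. c x = 0 \<longrightarrow> \<phi> x = 0"
  proof (rule AE_mp, intro AE_I2 impI)
    fix x assume x: "x \<in> space Q" "\<forall>E\<in>\<P>. measure P E = 0 \<longrightarrow> x \<in> E \<longrightarrow> \<phi> x = 0" "c x = 0"
    obtain E where E: "E \<in> \<P>" "x \<in> E" using ex[OF x(1)] by auto
    with x(3) have "a E = 0" using sum_ind[OF E] by (simp add: c_def)
    then have "measure P E = 0" using measure_P_eq_0[OF sets[OF E(1)]] by (auto simp: a_def)
    with x E show "\<phi> x = 0" by auto
  qed
  have "(\<Sum>E\<in>\<P>. rel_entropy_term (measure P E) (measure Q E))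
      = (\<Sum>E\<in>\<P>. ereal (measure P E * ln (a E)))"
    using measure_P_eq_0[OF sets] by (intro sum.cong) (auto simp: rel_entropy_term_def a_def)
  also have "\<dots> = ereal (\<integral>x. ln (c x) \<partial>P)"
    by (subst Bochner_Integration.integral_cong[OF refl ln_c])
       (simp_all, subst Bochner_Integration.integral_sum, auto simp: mult.commute less_top[symmetric])
  also have "\<dots> = ereal ((\<integral>x. ln (c x) \<partial>P) - (\<integral>x. c x \<partial>Q) + 1)" by (simp add: int_c)
  also have "\<dots> \<le> enn2ereal kl"
    by (rule tangent_le_kl[OF c_meas _ c0 int_c(2) int_ln])
       (auto simp: c_def a_def intro!: sum_nonneg)
  finally show "(\<Sum>E\<in>\<P>. rel_entropy_term (measure P E) (measure Q E)) \<le> enn2ereal kl" .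
qed

text \<open>The level sets of \<open>\<psi>\<close> form an admissible partition. On a level set
  with value \<open>v\<close> and probabilities \<open>p\<close>, \<open>q\<close>, the bound
  \<open>v p - exp v * q + p \<le> p ln (p / q)\<close> is \<open>ln y \<le> y - 1\<close> at
  \<open>y = exp v * q / p\<close>.\<close>

lemma rel_entropy_ge_simple:
  assumes \<psi>: "simple_function Q \<psi>"
  shows "ereal ((\<integral>x. \<psi> x \<partial>P) - (\<integral>x. exp (\<psi> x) \<partial>Q) + 1) \<le> rel_entropy Q P"
proof -
  define E where "E v = \<psi> -` {v} \<inter> space Q" for v
  define V where "V = \<psi> ` space Q"
  have fin: "finite V" unfolding V_def by (rule simple_functionD(1)[OF \<psi>])
  have sets [measurable]: "E v \<in> sets Q" for v unfolding E_def by (rule simple_functionD(2)[OF \<psi>])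
  have inj: "inj_on E V" by (auto simp: inj_on_def E_def V_def)
  have part: "partition_on (space Q) (E ` V)"
    by (rule partition_onI) (auto simp: E_def V_def disjnt_def)
  have sum_ind: "h (\<psi> x) = (\<Sum>v\<in>V. h v * indicator (E v) x)" if "x \<in> space Q"
    for h :: "real \<Rightarrow> real" and x
  proof -
    have "(\<Sum>v\<in>V. h v * indicator (E v) x) = (\<Sum>v\<in>{\<psi> x}. h v * indicator (E v) x)"
      using fin that by (intro sum.mono_neutral_right) (auto simp: V_def E_def)
    then show ?thesis using that by (simp add: E_def)
  qed
  have int: "(\<integral>x. h (\<psi> x) \<partial>N) = (\<Sum>v\<in>V. h v * measure N (E v))"
    if "prob_space N" "sets N = sets Q" for N and h :: "real \<Rightarrow> real"
  proof -
    interpret N: prob_space N by fact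
    have "x \<in> space N \<Longrightarrow> x \<in> space Q" for x using sets_eq_imp_space_eq[OF that(2)] by simp
    then have "(\<integral>x. h (\<psi> x) \<partial>N) = (\<integral>x. (\<Sum>v\<in>V. h v * indicator (E v) x) \<partial>N)"
      by (intro Bochner_Integration.integral_cong refl sum_ind)
    also have "\<dots> = (\<Sum>v\<in>V. h v * measure N (E v))"
      using sets that(2)
      by (subst Bochner_Integration.integral_sum) (auto simp: less_top[symmetric])
    finally show ?thesis .
  qed
  have P: "(\<integral>x. h (\<psi> x) \<partial>P) = (\<Sum>v\<in>V. h v * measure P (E v))" for h
    by (rule int) (auto intro: prob_space_density)
  have Q: "(\<integral>x. h (\<psi> x) \<partial>Q) = (\<Sum>v\<in>V. h v * measure Q (E v))" for h
    by (rule int) (auto intro: prob_space_axioms)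
  \<comment> \<open>The constant \<open>1\<close> is written as the total \<open>P\<close>-mass of
    the level sets, so that the inequality can be checked one level at a time.\<close>
  have "(\<integral>x. \<psi> x \<partial>P) - (\<integral>x. exp (\<psi> x) \<partial>Q) + 1
      = (\<Sum>v\<in>V. v * measure P (E v)) - (\<Sum>v\<in>V. exp v * measure Q (E v)) + (\<Sum>v\<in>V. measure P (E v))"
    using P[of "\<lambda>v. v"] Q[of exp] P[of "\<lambda>v. 1"] P.prob_space by simp
  also have "\<dots> = (\<Sum>v\<in>V. v * measure P (E v) - exp v * measure Q (E v) + measure P (E v))"
    by (simp add: sum_subtractf sum.distrib)
  also have "ereal \<dots> = (\<Sum>v\<in>V. ereal (v * measure P (E v) - exp v * measure Q (E v) + measure P (E v)))"
    by simp
  also have "\<dots> \<le> (\<Sum>v\<in>V. rel_entropy_term (measure P (E v)) (measure Q (E v)))"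
  proof (rule sum_mono)
    fix v
    let ?p = "measure P (E v)" and ?q = "measure Q (E v)"
    show "ereal (v * ?p - exp v * ?q + ?p) \<le> rel_entropy_term ?p ?q"
    proof (cases "?p = 0 \<or> ?q = 0")
      case False
      then have pq: "0 < ?p" "0 < ?q" by (auto simp: less_le)
      have "ln (exp v * ?q / ?p) \<le> exp v * ?q / ?p - 1"
        using pq by (intro ln_le_minus_one) auto
      moreover have "ln (exp v * ?q / ?p) = v - ln (?p / ?q)"
        using pq by (simp add: ln_div ln_mult)
      ultimately have "?p * (v - ln (?p / ?q)) \<le> ?p * (exp v * ?q / ?p - 1)"
        using pq by (intro mult_left_mono) auto
      also have "\<dots> = exp v * ?q - ?p" using pq by (simp add: field_simps)
      finally show ?thesis using False by (simp add: rel_entropy_term_def algebra_simps)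
    qed (auto simp: rel_entropy_term_def)
  qed
  also have "\<dots> = (\<Sum>A\<in>E ` V. rel_entropy_term (measure P A) (measure Q A))"
    using inj by (simp add: sum.reindex)
  also have "\<dots> \<le> rel_entropy Q P"
    unfolding rel_entropy_def by (rule SUP_upper) (use fin part sets in auto)
  finally show ?thesis .
qed

theorem rel_entropy_eq_kl: "rel_entropy Q P = enn2ereal kl"
proof (rule antisym[OF rel_entropy_le_kl])
  show "enn2ereal kl \<le> rel_entropy Q P"
  proof (rule ccontr)
    assume "\<not> ?thesis"
    then obtain r where r: "rel_entropy Q P < ereal r" "ereal r < enn2ereal kl"
      using ereal_dense2[of "rel_entropy Q P" "enn2ereal kl"] by (auto simp: not_le)
    obtain \<psi> where "simple_function Q \<psi>" "r < (\<integral>x. \<psi> x \<partial>P) - (\<integral>x. exp (\<psi> x) \<partial>Q) + 1"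
      by (rule ex_simple_function_less_kl[OF r(2)])
    with rel_entropy_ge_simple[of \<psi>] have "ereal r < rel_entropy Q P"
      by (meson ereal_less_eq(3) less_ereal.simps(1) less_le_trans)
    with r show False by simp
  qed
qed

end

section \<open>Product reference measures\<close>

text \<open>Lets a multiple of a possibly infinite entropy be bounded by testing only the reals
  below that entropy.\<close>

lemma ereal_mult_le_if_less:
  fixes K K' :: ereal
  assumes le: "\<And>r. ereal r < K \<Longrightarrow> ereal (real n * r) \<le> K'" and "0 \<le> K'"
  shows "ereal (real n) * K \<le> K'"
proof (cases "n = 0")
  case False
  show ?thesis
  proof (rule ccontr)
    assume "\<not> ?thesis"
    then have "K' / ereal (real n) < K"
      using False by (simp add: not_le ereal_divide_less_iff mult.commute)
    then obtain r where r: "K' / ereal (real n) < ereal r" "ereal r < K"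
      using ereal_dense2 by blast
    then have "K' < ereal (real n * r)"
      using False by (simp add: ereal_divide_less_iff mult.commute)
    with le[OF r(2)] show False by simp
  qed
qed (use \<open>0 \<le> K'\<close> in \<open>simp add: zero_ereal_def[symmetric]\<close>)

text \<open>
  The log-likelihood test functions of the variational formula add up over independent
  blocks, which makes relative entropy with respect to a product measure superadditive.
\<close>
lemma rel_entropy_indep_blocks:
  assumes "density_pair Q \<phi>" and "density_pair Q' \<phi>'" and B: "finite B"
    and indep: "prob_space.indep_vars Q' (\<lambda>_. Q) \<tau> B"
    and distr_Q: "\<And>b. b \<in> B \<Longrightarrow> distr Q' Q (\<tau> b) = Q"
    and distr_P: "\<And>b. b \<in> B \<Longrightarrow>
      distr (density Q' (\<lambda>x. ennreal (\<phi>' x))) Q (\<tau> b) = density Q (\<lambda>x. ennreal (\<phi> x))"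
  shows "ereal (real (card B)) * rel_entropy Q (density Q (\<lambda>x. ennreal (\<phi> x)))
    \<le> rel_entropy Q' (density Q' (\<lambda>x. ennreal (\<phi>' x)))"
proof -
  interpret D: density_pair Q \<phi> by fact
  interpret D': density_pair Q' \<phi>' by fact
  have meas [measurable]: "\<tau> b \<in> measurable Q' Q" if "b \<in> B" for b
    using indep that by (simp add: D'.indep_vars_def)
  have "ereal (real (card B) * r) \<le> enn2ereal D'.kl" if r: "ereal r < enn2ereal D.kl" for r
  proof -
    obtain \<psi> where \<psi>: "simple_function Q \<psi>"
      and r\<psi>: "r < (\<integral>x. \<psi> x \<partial>D.P) - (\<integral>x. exp (\<psi> x) \<partial>Q) + 1"
      by (rule D.ex_simple_function_less_kl[OF r])
    have \<psi>P: "simple_function D.P \<psi>" using \<psi> by (simp add: simple_function_def)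
    have [measurable]: "\<psi> \<in> borel_measurable Q" by (rule borel_measurable_simple_function[OF \<psi>])
    have int_exp: "integrable Q (\<lambda>x. exp (\<psi> x))"
      by (rule D.integrable_simple_function[OF simple_function_compose1[OF \<psi>]])
    have int_\<psi>: "integrable D.P \<psi>" by (rule D.P.integrable_simple_function[OF \<psi>P])
    define c where "c = (\<integral>x. exp (\<psi> x) \<partial>Q)"
    have c: "0 < c"
    proof -
      have "0 < (\<integral>x. exp (\<psi> x) \<partial>Q)"
        using D.integral_less_AE_space[of "\<lambda>_. 0" "\<lambda>x. exp (\<psi> x)"] int_exp D.emeasure_space_1
        by simp
      then show ?thesis by (simp add: c_def)
    qed
    \<comment> \<open>Normalising \<open>exp \<psi>\<close> to a \<open>Q\<close>-density is what
      makes the bound additive: products of normalised factors over independent blocks again have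
      integral \<open>1\<close>.\<close>
    define w where "w x = exp (\<psi> x) / c" for x
    have w_meas [measurable]: "w \<in> borel_measurable Q" unfolding w_def by measurable
    have w_pos: "0 < w x" for x using c by (simp add: w_def)
    have w_int: "(\<integral>x. w x \<partial>Q) = 1" "integrable Q w"
      using c int_exp by (auto simp: w_def[abs_def] c_def)
    have ln_w: "ln (w x) = \<psi> x - ln c" for x using c by (simp add: w_def ln_div)
    define W where "W x = (\<Prod>b\<in>B. w (\<tau> b x))" for x
    have W_meas [measurable]: "W \<in> borel_measurable Q'" unfolding W_def by measurable
    have W_pos: "0 < W x" for x unfolding W_def by (intro prod_pos) (simp add: w_pos)
    have ind: "D'.indep_vars (\<lambda>_. borel) (\<lambda>b x. w (\<tau> b x)) B"
      by (rule D'.indep_vars_compose2[OF indep]) simp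
    have int_w\<tau>: "integrable Q' (\<lambda>x. w (\<tau> b x))" "(\<integral>x. w (\<tau> b x) \<partial>Q') = 1" if "b \<in> B" for b
      using integrable_distr_eq[OF meas[OF that], of w] integral_distr[OF meas[OF that], of w]
        w_int distr_Q[OF that] by auto
    have W_int: "integrable Q' W" "(\<integral>x. W x \<partial>Q') = 1"
      using D'.indep_vars_integrable[OF B ind int_w\<tau>(1)]
        D'.indep_vars_lebesgue_integral[OF B ind int_w\<tau>(1)]
      by (auto simp: W_def[abs_def] int_w\<tau>(2))
    have ln_W: "ln (W x) = (\<Sum>b\<in>B. \<psi> (\<tau> b x) - ln c)" for x
      unfolding W_def using w_pos by (subst ln_prod) (simp_all add: ln_w B less_imp_neq[symmetric])
    have meas': "\<tau> b \<in> measurable D'.P Q" if "b \<in> B" for b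
      using meas[OF that] by simp
    have int_\<psi>\<tau>: "integrable D'.P (\<lambda>x. \<psi> (\<tau> b x))"
      "(\<integral>x. \<psi> (\<tau> b x) \<partial>D'.P) = (\<integral>x. \<psi> x \<partial>D.P)" if "b \<in> B" for b
      using integrable_distr_eq[OF meas'[OF that], of \<psi>] integral_distr[OF meas'[OF that], of \<psi>]
        int_\<psi> distr_P[OF that] by auto
    have int_lnW: "integrable D'.P (\<lambda>x. ln (W x))"
      unfolding ln_W by (intro Bochner_Integration.integrable_sum Bochner_Integration.integrable_diff int_\<psi>\<tau>) auto
    \<comment> \<open>The linear form of the functional is at most its logarithmic form, because
      \<open>ln c \<le> c - 1\<close>.\<close>
    have "r \<le> (\<integral>x. \<psi> x \<partial>D.P) - ln c"
      using r\<psi> ln_le_minus_one[OF c] by (simp add: c_def)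
    then have "real (card B) * r \<le> real (card B) * ((\<integral>x. \<psi> x \<partial>D.P) - ln c)"
      by (intro mult_left_mono) auto
    \<comment> \<open>Independence was used for \<open>Q'\<close> only. Under \<open>D'.P\<close>
      the logarithm of \<open>W\<close> is a sum, so linearity and the law of each single block
      suffice.\<close>
    also have "\<dots> = (\<integral>x. ln (W x) \<partial>D'.P)"
      unfolding ln_W using int_\<psi>\<tau> D'.P.prob_space by (subst Bochner_Integration.integral_sum) auto
    finally have "ereal (real (card B) * r) \<le> ereal ((\<integral>x. ln (W x) \<partial>D'.P) - (\<integral>x. W x \<partial>Q') + 1)"
      using W_int by simp
    also have "\<dots> \<le> enn2ereal D'.kl"
      using W_pos by (intro D'.tangent_le_kl W_meas W_int int_lnW) (auto simp: less_imp_le less_imp_neq[symmetric])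
    finally show ?thesis .
  qed
  then show ?thesis
    unfolding D.rel_entropy_eq_kl D'.rel_entropy_eq_kl
    by (rule ereal_mult_le_if_less) auto
qed

text \<open>The coordinates are independent under a product measure, hence so are their restrictions
  to disjoint index sets. Each block is such a restriction, relabelled by \<open>J\<close> through
  \<open>\<sigma> b\<close>.\<close>

lemma indep_vars_PiM_blocks:
  fixes D :: "'b measure"
  assumes D: "prob_space D" and sh: "\<And>b. b \<in> B \<Longrightarrow> \<sigma> b \<in> J \<rightarrow> I"
    and disj: "disjoint_family_on (\<lambda>b. \<sigma> b ` J) B"
  shows "prob_space.indep_vars (PiM I (\<lambda>_. D)) (\<lambda>_. PiM J (\<lambda>_. D)) (\<lambda>b x. \<lambda>g\<in>J. x (\<sigma> b g)) B"
proof -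
  interpret prob_space "PiM I (\<lambda>_. D)" by (rule prob_space_PiM) (rule D)
  have "indep_vars (\<lambda>_. D) (\<lambda>i x. x i) I"
  proof (cases "I = {}")
    case False
    have 1: "distr (PiM I (\<lambda>_. D)) (PiM I (\<lambda>_. D)) (\<lambda>x. \<lambda>i\<in>I. x i) = PiM I (\<lambda>_. D)"
      by (subst distr_cong[OF refl refl, of _ _ "\<lambda>x. x"])
         (auto simp: space_PiM PiE_def extensional_restrict)
    have 2: "distr (PiM I (\<lambda>_. D)) D (\<lambda>x. x i) = D" if "i \<in> I" for i
      by (rule distr_PiM_component) (use D that in auto)
    show ?thesis
      using False by (subst indep_vars_iff_distr_eq_PiM') (auto simp: 1 2 cong: PiM_cong)
  next
    case True
    show ?thesis unfolding indep_vars_def indep_sets_def by (simp add: True)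
  qed
  then have "indep_vars (\<lambda>b. PiM (\<sigma> b ` J) (\<lambda>_. D)) (\<lambda>b x. restrict (\<lambda>i. x i) (\<sigma> b ` J)) B"
    by (rule indep_vars_restrict) (use sh disj in auto)
  then have "indep_vars (\<lambda>_. PiM J (\<lambda>_. D))
      (\<lambda>b x. (\<lambda>y. \<lambda>g\<in>J. y (\<sigma> b g)) (restrict (\<lambda>i. x i) (\<sigma> b ` J))) B"
    by (rule indep_vars_compose2) (intro measurable_restrict measurable_component_singleton; auto)
  moreover have "(\<lambda>b x. (\<lambda>y. \<lambda>g\<in>J. y (\<sigma> b g)) (restrict (\<lambda>i. x i) (\<sigma> b ` J)))
      = (\<lambda>b x. \<lambda>g\<in>J. x (\<sigma> b g) :: 'b)"
    by (auto simp: fun_eq_iff restrict_def)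
  ultimately show ?thesis by (simp only:)
qed

text \<open>A product measure is determined by its values on boxes, and there the integral of the
  product density factors by Tonelli's theorem.\<close>

lemma PiM_density:
  assumes R: "sigma_finite_measure R" and I: "finite I"
    and [measurable]: "f \<in> borel_measurable R" and f: "\<And>t. 0 \<le> f t"
    and D: "prob_space (density R (\<lambda>t. ennreal (f t)))"
  shows "PiM I (\<lambda>_. density R (\<lambda>t. ennreal (f t)))
    = density (PiM I (\<lambda>_. R)) (\<lambda>x. ennreal (\<Prod>i\<in>I. f (x i)))"
proof -
  interpret R: product_sigma_finite "\<lambda>_. R" by (simp add: product_sigma_finite_def R)
  interpret D: product_sigma_finite "\<lambda>_. density R (\<lambda>t. ennreal (f t))"
    by (simp add: product_sigma_finite_def prob_space_imp_sigma_finite[OF D])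
  show ?thesis
  proof (rule D.PiM_eqI[OF I, symmetric])
    show "sets (density (PiM I (\<lambda>_. R)) (\<lambda>x. ennreal (\<Prod>i\<in>I. f (x i))))
        = sets (PiM I (\<lambda>_. density R (\<lambda>t. ennreal (f t))))"
      by (simp cong: sets_PiM_cong)
    fix A assume "\<And>i. i \<in> I \<Longrightarrow> A i \<in> sets (density R (\<lambda>t. ennreal (f t)))"
    then have A [measurable]: "A i \<in> sets R" if "i \<in> I" for i using that by simp
    have PiA [measurable]: "Pi\<^sub>E I A \<in> sets (PiM I (\<lambda>_. R))"
      using I A by (intro sets_PiM_I_finite) auto
    have "emeasure (density (PiM I (\<lambda>_. R)) (\<lambda>x. ennreal (\<Prod>i\<in>I. f (x i)))) (Pi\<^sub>E I A)
        = (\<integral>\<^sup>+ x. ennreal (\<Prod>i\<in>I. f (x i)) * indicator (Pi\<^sub>E I A) x \<partial>PiM I (\<lambda>_. R))"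
      by (rule emeasure_density) auto
    also have "\<dots> = (\<integral>\<^sup>+ x. (\<Prod>i\<in>I. ennreal (f (x i)) * indicator (A i) (x i)) \<partial>PiM I (\<lambda>_. R))"
    proof (rule nn_integral_cong)
      fix x assume "x \<in> space (PiM I (\<lambda>_. R))"
      then have "indicator (Pi\<^sub>E I A) x = (\<Prod>i\<in>I. indicator (A i) (x i) :: ennreal)"
        using I by (auto simp: indicator_def space_PiM PiE_def Pi_def prod_zero_iff)
      then show "ennreal (\<Prod>i\<in>I. f (x i)) * indicator (Pi\<^sub>E I A) x
          = (\<Prod>i\<in>I. ennreal (f (x i)) * indicator (A i) (x i))"
        by (simp add: prod.distrib prod_ennreal f)
    qed
    also have "\<dots> = (\<Prod>i\<in>I. \<integral>\<^sup>+ t. ennreal (f t) * indicator (A i) t \<partial>R)"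
      by (rule R.product_nn_integral_prod[OF I]) measurable
    also have "\<dots> = (\<Prod>i\<in>I. emeasure (density R (\<lambda>t. ennreal (f t))) (A i))"
      by (intro prod.cong refl emeasure_density[symmetric]) auto
    finally show "emeasure (density (PiM I (\<lambda>_. R)) (\<lambda>x. ennreal (\<Prod>i\<in>I. f (x i)))) (Pi\<^sub>E I A)
        = (\<Prod>i\<in>I. emeasure (density R (\<lambda>t. ennreal (f t))) (A i))" .
  qed
qed

text \<open>The joint density \<open>p\<close> of \<open>N\<close> is divided by the product
  \<open>g\<close> of the marginal densities; the quotient \<open>\<phi>\<close> is the density with
  respect to the product measure. Taking logarithms splits \<open>ln p\<close> into
  \<open>ln \<phi>\<close>, which integrates to the relative entropy, and a sum whose terms depend
  on the marginals alone.\<close>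

lemma
  fixes R :: "'b measure" and f :: "'b \<Rightarrow> real" and N :: "('i \<Rightarrow> 'b) measure"
  assumes R: "sigma_finite_measure R" and I: "finite I"
    and f_meas [measurable]: "f \<in> borel_measurable R" and f: "\<And>t. 0 \<le> f t"
    and D: "prob_space (density R (\<lambda>t. ennreal (f t)))"
    and flnf: "(\<integral>\<^sup>+ t. ennreal (- (f t * ln (f t))) \<partial>R) < \<infinity>"
    and N: "prob_space N" "sets N = sets (PiM I (\<lambda>_. R))" "absolutely_continuous (PiM I (\<lambda>_. R)) N"
    and marg: "\<And>i. i \<in> I \<Longrightarrow> distr N R (\<lambda>x. x i) = density R (\<lambda>t. ennreal (f t))"
  shows ex_density_pair_PiM: "\<exists>\<phi>. density_pair (PiM I (\<lambda>_. density R (\<lambda>t. ennreal (f t)))) \<phi> \<and>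
      N = density (PiM I (\<lambda>_. density R (\<lambda>t. ennreal (f t)))) (\<lambda>x. ennreal (\<phi> x))"
    and diff_entropy_eq_rel_entropy: "diff_entropy (PiM I (\<lambda>_. R)) N =
      - (rel_entropy (PiM I (\<lambda>_. density R (\<lambda>t. ennreal (f t)))) N
         + ereal (real (card I)) * ext_integral R (\<lambda>t. f t * ln (f t)))"
proof -
  define L where "L = PiM I (\<lambda>_. R)"
  define Q where "Q = PiM I (\<lambda>_. density R (\<lambda>t. ennreal (f t)))"
  define p where "p = RN_deriv L N"
  define g where "g x = (\<Prod>i\<in>I. f (x i))" for x
  \<comment> \<open>Where \<open>g x = 0\<close> or \<open>p x\<close> is infinite this is
    \<open>0\<close>; both exceptional sets are null for \<open>N\<close>.\<close>
  define \<phi> where "\<phi> x = enn2real (p x) / g x" for x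
  interpret R: product_sigma_finite "\<lambda>_. R" by (simp add: product_sigma_finite_def R)
  interpret L: sigma_finite_measure L unfolding L_def by (rule R.sigma_finite[OF I])
  interpret N: prob_space N by fact
  have NL: "sets N = sets L" "absolutely_continuous L N" using N by (auto simp: L_def)
  note [measurable_cong] = NL(1)
  have coord [measurable]: "(\<lambda>x. x i) \<in> measurable L R" if "i \<in> I" for i
    unfolding L_def using that by simp
  have coordN: "(\<lambda>x. x i) \<in> measurable N R" if "i \<in> I" for i
    using coord[OF that] by measurable
  have g_meas [measurable]: "g \<in> borel_measurable L"
    unfolding g_def by (intro borel_measurable_prod measurable_compose[OF coord f_meas])
  have g_nonneg: "0 \<le> g x" for x unfolding g_def by (intro prod_nonneg) (simp add: f)
  have p_meas [measurable]: "p \<in> borel_measurable L" unfolding p_def by simp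
  have \<phi>_meas [measurable]: "\<phi> \<in> borel_measurable L" unfolding \<phi>_def by measurable
  have \<phi>_nonneg: "0 \<le> \<phi> x" for x by (simp add: \<phi>_def g_nonneg)
  have Np: "N = density L p" unfolding p_def using NL by (simp add: L.density_RN_deriv)
  have Q: "Q = density L (\<lambda>x. ennreal (g x))"
    unfolding Q_def L_def g_def by (rule PiM_density[OF R I f_meas f D])
  interpret Q: prob_space Q unfolding Q_def by (rule prob_space_PiM) (rule D)
  have p_fin: "AE x in L. p x \<noteq> \<infinity>"
    unfolding p_def using NL by (intro L.RN_deriv_finite) (auto intro: prob_space_imp_sigma_finite N)
  \<comment> \<open>The marginal law has density \<open>f\<close>, so it gives no mass to the zero
    set of \<open>f\<close>.\<close>
  have f_pos: "AE x in N. f (x i) \<noteq> 0" if "i \<in> I" for i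
  proof -
    have "AE t in density R (\<lambda>t. ennreal (f t)). f t \<noteq> 0"
      by (subst AE_density) auto
    then have "AE t in distr N R (\<lambda>x. x i). f t \<noteq> 0" by (simp only: marg[OF that])
    then show ?thesis by (rule AE_distrD[OF coordN[OF that]])
  qed
  have fs_pos: "AE x in N. \<forall>i\<in>I. f (x i) \<noteq> 0"
    by (rule AE_finite_allI[OF I f_pos])
  have g_pos: "AE x in N. g x \<noteq> 0"
    using fs_pos by eventually_elim (simp add: g_def I)
  have p_g: "AE x in L. p x \<noteq> 0 \<longrightarrow> g x \<noteq> 0"
    using g_pos unfolding Np by (subst (asm) AE_density) (auto simp: zero_less_iff_neq_zero)
  have Nphi: "N = density Q (\<lambda>x. ennreal (\<phi> x))"
  proof -
    have "density Q (\<lambda>x. ennreal (\<phi> x)) = density L (\<lambda>x. ennreal (g x) * ennreal (\<phi> x))"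
      unfolding Q by (rule density_density_eq) measurable
    also have "\<dots> = density L p"
    proof (rule density_cong)
      show "AE x in L. ennreal (g x) * ennreal (\<phi> x) = p x"
        using p_fin p_g
      proof eventually_elim
        fix x assume x: "p x \<noteq> \<infinity>" "p x \<noteq> 0 \<longrightarrow> g x \<noteq> 0"
        have "ennreal (g x) * ennreal (\<phi> x) = ennreal (g x * \<phi> x)"
          by (simp add: ennreal_mult g_nonneg \<phi>_nonneg)
        also have "g x * \<phi> x = enn2real (p x)" using x(2) by (auto simp: \<phi>_def)
        also have "ennreal \<dots> = p x" using x(1) by (simp add: top.not_eq_extremum)
        finally show "ennreal (g x) * ennreal (\<phi> x) = p x" .
      qed
    qed auto
    finally show ?thesis using Np by simp
  qed
  have dp: "density_pair Q \<phi>"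
  proof (intro density_pair.intro density_pair_axioms.intro Q.prob_space_axioms)
    show "\<phi> \<in> borel_measurable Q" unfolding Q by measurable
    show "prob_space (density Q (\<lambda>x. ennreal (\<phi> x)))" using N(1) Nphi by simp
  qed (rule \<phi>_nonneg)
  then show "\<exists>\<phi>. density_pair (PiM I (\<lambda>_. density R (\<lambda>t. ennreal (f t)))) \<phi> \<and>
      N = density (PiM I (\<lambda>_. density R (\<lambda>t. ennreal (f t)))) (\<lambda>x. ennreal (\<phi> x))"
    using Nphi by (auto simp: Q_def)
  interpret dp: density_pair Q \<phi> by fact
  \<comment> \<open>Only almost everywhere: splitting the logarithm requires \<open>p\<close> to be
    positive and finite and every \<open>f (x i)\<close> to be positive.\<close>
  have ln_p: "AE x in N. ln (enn2real (p x)) = ln (\<phi> x) + (\<Sum>i\<in>I. ln (f (x i)))"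
  proof -
    have "AE x in N. p x \<noteq> 0 \<and> p x \<noteq> \<infinity>"
      using p_fin unfolding Np by (subst AE_density) auto
    then show ?thesis using fs_pos
    proof eventually_elim
      fix x assume x: "p x \<noteq> 0 \<and> p x \<noteq> \<infinity>" "\<forall>i\<in>I. f (x i) \<noteq> 0"
      have fx: "0 < f (x i)" if "i \<in> I" for i using x(2) f[of "x i"] that by (simp add: less_le)
      then have gx: "0 < g x" unfolding g_def by (intro prod_pos) auto
      have px: "0 < enn2real (p x)" using x(1)
        by (simp add: enn2real_positive_iff zero_less_iff_neq_zero top.not_eq_extremum)
      have "ln (enn2real (p x)) = ln (\<phi> x * g x)" using gx by (simp add: \<phi>_def)
      also have "\<dots> = ln (\<phi> x) + ln (g x)" using px gx by (intro ln_mult_pos) (auto simp: \<phi>_def)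
      also have "ln (g x) = (\<Sum>i\<in>I. ln (f (x i)))"
        unfolding g_def using x(2) I by (intro ln_prod) auto
      finally show "ln (enn2real (p x)) = ln (\<phi> x) + (\<Sum>i\<in>I. ln (f (x i)))" .
    qed
  qed
  have ln_meas: "(\<lambda>x. ln (f (x i))) \<in> borel_measurable N" if "i \<in> I" for i
    using measurable_compose[OF coordN[OF that] f_meas] by measurable
  have ext_i: "ext_integral N (\<lambda>x. ln (f (x i))) = ext_integral R (\<lambda>t. f t * ln (f t))"
    if "i \<in> I" for i
  proof -
    have "ext_integral N (\<lambda>x. ln (f (x i))) = ext_integral (distr N R (\<lambda>x. x i)) (\<lambda>t. ln (f t))"
      using coordN[OF that] by (subst ext_integral_distr) auto
    also have "\<dots> = ext_integral R (\<lambda>t. f t * ln (f t))"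
      unfolding marg[OF that] by (rule ext_integral_density) (auto simp: f)
    finally show ?thesis .
  qed
  have neg_i: "(\<integral>\<^sup>+ x. ennreal (- ln (f (x i))) \<partial>N) < \<infinity>" if "i \<in> I" for i
  proof -
    have "(\<integral>\<^sup>+ x. ennreal (- ln (f (x i))) \<partial>N)
        = (\<integral>\<^sup>+ t. ennreal (- ln (f t)) \<partial>distr N R (\<lambda>x. x i))"
      using coordN[OF that] by (subst nn_integral_distr) auto
    also have "\<dots> = (\<integral>\<^sup>+ t. ennreal (- (f t * ln (f t))) \<partial>R)"
      unfolding marg[OF that]
      by (subst nn_integral_density) (auto intro!: nn_integral_cong simp: f simp flip: ennreal_mult')
    finally show ?thesis using flnf by simp
  qed
  have sum: "ext_integral N (\<lambda>x. \<Sum>i\<in>I. ln (f (x i))) = (\<Sum>i\<in>I. ext_integral N (\<lambda>x. ln (f (x i))))"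
    "(\<integral>\<^sup>+ x. ennreal (- (\<Sum>i\<in>I. ln (f (x i)))) \<partial>N) < \<infinity>"
    using ext_integral_sum[OF I ln_meas neg_i] by auto
  have "ext_integral N (\<lambda>x. ln (enn2real (p x)))
      = ext_integral N (\<lambda>x. ln (\<phi> x) + (\<Sum>i\<in>I. ln (f (x i))))"
    by (rule ext_integral_cong_AE[OF ln_p])
  also have "\<dots> = ext_integral N (\<lambda>x. ln (\<phi> x)) + ext_integral N (\<lambda>x. \<Sum>i\<in>I. ln (f (x i)))"
  proof (rule ext_integral_add)
    show "(\<lambda>x. ln (\<phi> x)) \<in> borel_measurable N" by measurable
    show "(\<lambda>x. \<Sum>i\<in>I. ln (f (x i))) \<in> borel_measurable N"
      by (intro borel_measurable_sum ln_meas)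
    show "(\<integral>\<^sup>+ x. ennreal (- ln (\<phi> x)) \<partial>N) < \<infinity>"
      using dp.nn_integral_neg_ln_density by (simp flip: Nphi)
  qed (rule sum(2))
  also have "ext_integral N (\<lambda>x. ln (\<phi> x)) = rel_entropy Q N"
    using dp.ext_integral_ln_density dp.rel_entropy_eq_kl by (simp flip: Nphi)
  also have "ext_integral N (\<lambda>x. \<Sum>i\<in>I. ln (f (x i)))
      = ereal (real (card I)) * ext_integral R (\<lambda>t. f t * ln (f t))"
    by (simp add: sum(1) ext_i sum_constant_ereal mult.commute)
  finally show "diff_entropy (PiM I (\<lambda>_. R)) N =
      - (rel_entropy (PiM I (\<lambda>_. density R (\<lambda>t. ennreal (f t)))) N
         + ereal (real (card I)) * ext_integral R (\<lambda>t. f t * ln (f t)))"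
    by (simp add: diff_entropy_def p_def L_def Q_def)
qed

section \<open>Superadditive sequences and stationary fields\<close>

text \<open>A version of Fekete's lemma for squares. The upper bound is immediate; for the lower
  one, fix \<open>m\<close> with quotient close to the supremum and note that the part of the
  \<open>n\<close> square covered by \<open>m\<close> squares has relative area tending to
  \<open>1\<close>.\<close>

lemma tendsto_SUP_of_square_superadditive:
  fixes K :: "nat \<Rightarrow> ereal"
  assumes nonneg: "\<And>n. 0 \<le> K n"
    and super: "\<And>m n. 1 \<le> m \<Longrightarrow> ereal (real ((n div m)\<^sup>2)) * K m \<le> K n"
  shows "(\<lambda>n. K n / ereal ((real n)\<^sup>2)) \<longlonglongrightarrow> (SUP n\<in>{1..}. K n / ereal ((real n)\<^sup>2))"
proof (rule order_tendstoI)
  fix a assume "(SUP n\<in>{1..}. K n / ereal ((real n)\<^sup>2)) < a"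
  then show "\<forall>\<^sub>F n in sequentially. K n / ereal ((real n)\<^sup>2) < a"
    by (intro eventually_sequentiallyI[of 1]) (rule SUP_lessD, assumption, simp)
next
  fix a assume "a < (SUP n\<in>{1..}. K n / ereal ((real n)\<^sup>2))"
  then obtain m where m: "1 \<le> m" "a < K m / ereal ((real m)\<^sup>2)"
    by (auto simp: less_SUP_iff)
  define c where "c n = (real (n div m) * real m / real n)\<^sup>2" for n
  have "(\<lambda>n. real (n mod m) / real n) \<longlonglongrightarrow> 0"
  proof (rule tendsto_sandwich[OF _ _ tendsto_const lim_const_over_n])
    show "\<forall>\<^sub>F n in sequentially. real (n mod m) / real n \<le> real m / real n"
      using m(1) by (intro always_eventually allI divide_right_mono) (auto simp: less_imp_le)
  qed auto
  then have "(\<lambda>n. 1 - real (n mod m) / real n) \<longlonglongrightarrow> 1 - 0"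
    by (intro tendsto_diff tendsto_const)
  moreover have "\<forall>\<^sub>F n in sequentially. 1 - real (n mod m) / real n = real (n div m) * real m / real n"
  proof (rule eventually_sequentiallyI[of 1])
    fix n :: nat assume "1 \<le> n"
    moreover have "real n = real (n div m) * real m + real (n mod m)"
      by (metis div_mult_mod_eq of_nat_add of_nat_mult)
    ultimately show "1 - real (n mod m) / real n = real (n div m) * real m / real n"
      by (simp add: field_simps)
  qed
  ultimately have "(\<lambda>n. real (n div m) * real m / real n) \<longlonglongrightarrow> 1 - 0"
    by (rule Lim_transform_eventually)
  then have "c \<longlonglongrightarrow> (1 - 0)\<^sup>2" unfolding c_def by (rule tendsto_power)
  then have "(\<lambda>n. ereal (c n)) \<longlonglongrightarrow> 1" by (simp add: one_ereal_def)
  \<comment> \<open>The factor tends to \<open>1\<close>, neither zero nor infinite, so the limit of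
    the product is valid even if \<open>K m\<close> is infinite.\<close>
  then have "(\<lambda>n. ereal (c n) * (K m / ereal ((real m)\<^sup>2))) \<longlonglongrightarrow> 1 * (K m / ereal ((real m)\<^sup>2))"
    by (rule tendsto_mult_ereal) auto
  then have "\<forall>\<^sub>F n in sequentially. a < ereal (c n) * (K m / ereal ((real m)\<^sup>2))"
    using m(2) by (auto intro: order_tendstoD)
  then show "\<forall>\<^sub>F n in sequentially. a < K n / ereal ((real n)\<^sup>2)"
    using eventually_ge_at_top[of 1]
  proof eventually_elim
    case (elim n)
    have "ereal (c n) * (K m / ereal ((real m)\<^sup>2)) = ereal (real ((n div m)\<^sup>2)) * K m / ereal ((real n)\<^sup>2)"
      using m(1) elim(2) nonneg[of m]
      by (cases "K m"; cases "n div m = 0") (auto simp: c_def power_divide power_mult_distrib)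
    also have "\<dots> \<le> K n / ereal ((real n)\<^sup>2)"
      using elim(2) by (intro ereal_divide_right_mono super m(1)) auto
    finally show ?case using elim(1) by (rule less_le_trans[rotated])
  qed
qed

lemma distr_funpow:
  assumes T [measurable]: "T \<in> measurable M M" and "distr M M T = M"
  shows "distr M M (T ^^ n) = M"
proof (induction n)
  case (Suc n)
  have [measurable]: "T ^^ k \<in> measurable M M" for k
    using measurable_compose_n[OF T] .
  have "distr M M (T ^^ Suc n) = distr (distr M M (T ^^ n)) M T"
    by (subst distr_distr) auto
  then show ?case by (simp only: Suc assms(2))
qed (simp add: distr_id2 id_def)

lemma funpow_commute_on:
  assumes "\<And>x. x \<in> A \<Longrightarrow> T (S x) = S (T x)" "\<And>x. x \<in> A \<Longrightarrow> T x \<in> A" "\<And>x. x \<in> A \<Longrightarrow> S x \<in> A"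
    and x: "x \<in> A"
  shows "(T ^^ a) ((S ^^ b) x) = (S ^^ b) ((T ^^ a) x)"
proof -
  have T_in: "(T ^^ n) y \<in> A" if "y \<in> A" for y n
    using that by (induction n) (auto simp: assms)
  have S_in: "(S ^^ n) y \<in> A" if "y \<in> A" for y n
    using that by (induction n) (auto simp: assms)
  have 1: "T ((S ^^ b) y) = (S ^^ b) (T y)" if "y \<in> A" for y
    using that by (induction b) (auto simp: assms S_in)
  show ?thesis
    using x by (induction a) (auto simp: 1 T_in)
qed

text \<open>The tangent inequality at the standard normal density bounds \<open>- f ln f\<close> by
  the sum of \<open>f\<close> times a quadratic polynomial and the normal density, which is
  integrable.\<close>

lemma nn_integral_neg_xlnx_density:
  fixes f :: "real \<Rightarrow> real"
  assumes f: "\<And>t. 0 \<le> f t" and dist: "distributed M lborel F (\<lambda>t. ennreal (f t))"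
    and "prob_space M" and sq: "integrable M (\<lambda>x. (F x)\<^sup>2)"
  shows "(\<integral>\<^sup>+ t. ennreal (- (f t * ln (f t))) \<partial>lborel) < \<infinity>"
proof -
  interpret prob_space M by fact
  define k where "k = \<bar>ln (sqrt (2 * pi))\<bar>"
  define h where "h t = f t * (t\<^sup>2 / 2 + k) + std_normal_density t" for t
  have h_nonneg: "0 \<le> h t" for t
    by (simp add: h_def f k_def normal_density_nonneg)
  \<comment> \<open>Comparing \<open>f\<close> with the Gaussian density is where the second moment enters.\<close>
  have le: "- (f t * ln (f t)) \<le> h t" for t
  proof -
    have pos: "0 < std_normal_density t" by (rule normal_density_pos) simp
    have ln: "ln (std_normal_density t) = - ln (sqrt (2 * pi)) - t\<^sup>2 / 2"
      by (simp add: std_normal_density_def ln_mult ln_div)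
    have "f t * (- k - t\<^sup>2 / 2) \<le> f t * ln (std_normal_density t)"
      unfolding ln using f by (intro mult_left_mono) (auto simp: k_def)
    moreover have "f t * ln (std_normal_density t) - std_normal_density t + 1 \<le> entropy_fun (f t)"
      by (rule entropy_fun_ge_tangent[OF f pos])
    ultimately show ?thesis
      using f[of t] by (simp add: h_def entropy_fun_def algebra_simps)
  qed
  have "integrable lborel (\<lambda>t. f t * (t\<^sup>2 / 2 + k))"
    using sq by (subst distributed_integrable[OF dist]) (auto simp: f)
  then have int: "integrable lborel h"
    unfolding h_def by (intro Bochner_Integration.integrable_add integrable_normal_density) auto
  have "(\<integral>\<^sup>+ t. ennreal (- (f t * ln (f t))) \<partial>lborel) \<le> (\<integral>\<^sup>+ t. ennreal (h t) \<partial>lborel)"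
    by (intro nn_integral_mono ennreal_leI le)
  also have "\<dots> < \<infinity>"
    using int by (auto simp: real_integrable_def top.not_eq_extremum)
  finally show ?thesis .
qed

section \<open>The stationary field generated by two commuting transformations\<close>

locale stationary_field = prob_space M
  for M :: "'a measure" and T S :: "'a \<Rightarrow> 'a" and F :: "'a \<Rightarrow> real" and f :: "real \<Rightarrow> real" +
  assumes T: "invertible_mpt M T" and S: "invertible_mpt M S"
    and commute: "x \<in> space M \<Longrightarrow> T (S x) = S (T x)"
    and F_meas [measurable]: "F \<in> borel_measurable M"
    and F_sq: "integrable M (\<lambda>x. (F x)\<^sup>2)"
    and ac: "abs_cont_process M (orbit_process M T S F)"
    and f_nonneg: "0 \<le> f t" and F_distributed: "distributed M lborel F (\<lambda>t. ennreal (f t))"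
begin

abbreviation X :: "int \<times> int \<Rightarrow> 'a \<Rightarrow> real" where
  "X \<equiv> orbit_process M T S F"

abbreviation D :: "real measure" where
  "D \<equiv> density lborel (\<lambda>t. ennreal (f t))"

abbreviation leb :: "nat \<Rightarrow> (int \<times> int \<Rightarrow> real) measure" where
  "leb n \<equiv> PiM (grid n) (\<lambda>_. lborel)"

abbreviation \<pi> :: "nat \<Rightarrow> (int \<times> int \<Rightarrow> real) measure" where
  "\<pi> n \<equiv> PiM (grid n) (\<lambda>_. D)"

abbreviation \<mu> :: "nat \<Rightarrow> (int \<times> int \<Rightarrow> real) measure" where
  "\<mu> n \<equiv> joint_law M X (grid n)"

text \<open>A genuine translation only for nonnegative coordinates, since \<open>nat\<close> sends
  negative ones to \<open>0\<close>. All grids and the translates used below lie in that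
  quadrant.\<close>

definition shift :: "int \<times> int \<Rightarrow> 'a \<Rightarrow> 'a" where
  "shift h = (T ^^ nat (fst h)) \<circ> (S ^^ nat (snd h))"

lemma T_meas: "T \<in> measurable M M" and distr_T: "distr M M T = M"
  and S_meas: "S \<in> measurable M M" and distr_S: "distr M M S = M"
  using T S by (auto simp: invertible_mpt_def)

lemma shift_measurable [measurable]: "shift h \<in> measurable M M"
  unfolding shift_def
  by (rule measurable_comp[OF measurable_compose_n[OF S_meas] measurable_compose_n[OF T_meas]])

lemma distr_shift: "distr M M (shift h) = M"
proof -
  have "distr M M (shift h) = distr (distr M M (S ^^ nat (snd h))) M (T ^^ nat (fst h))"
    unfolding shift_def
    by (rule distr_distr[symmetric, OF measurable_compose_n[OF T_meas] measurable_compose_n[OF S_meas]])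
  then show ?thesis
    by (simp add: distr_funpow T_meas S_meas distr_T distr_S)
qed

lemma X_eq_shift: "0 \<le> fst g \<Longrightarrow> 0 \<le> snd g \<Longrightarrow> X g = F \<circ> shift g"
  by (simp add: orbit_process_def int_iter_def shift_def comp_assoc)

lemma X_measurable: "0 \<le> fst g \<Longrightarrow> 0 \<le> snd g \<Longrightarrow> X g \<in> borel_measurable M"
  unfolding X_eq_shift by measurable

text \<open>The commutation hypothesis enters here: the power of \<open>T\<close> belonging to
  \<open>h\<close> has to be moved past the power of \<open>S\<close> belonging to
  \<open>g\<close>.\<close>

lemma shift_add:
  assumes "0 \<le> fst g" "0 \<le> snd g" "0 \<le> fst h" "0 \<le> snd h" and \<omega>: "\<omega> \<in> space M"
  shows "shift (g + h) \<omega> = shift g (shift h \<omega>)"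
proof -
  have T_in: "T x \<in> space M" and S_in: "S x \<in> space M" if "x \<in> space M" for x
    using T_meas S_meas that by (auto dest: measurable_space)
  have "(S ^^ nat (snd h)) \<omega> \<in> space M"
    using measurable_space[OF measurable_compose_n[OF S_meas] \<omega>] .
  then show ?thesis
    using assms funpow_commute_on[of "space M" T S, OF commute T_in S_in]
    by (simp add: shift_def nat_add_distrib funpow_add)
qed

lemma X_add:
  assumes "0 \<le> fst g" "0 \<le> snd g" "0 \<le> fst h" "0 \<le> snd h" and "\<omega> \<in> space M"
  shows "X (g + h) \<omega> = X g (shift h \<omega>)"
  using assms by (simp add: X_eq_shift shift_add)

lemma grid_nonneg: "g \<in> grid n \<Longrightarrow> 0 \<le> fst g" "g \<in> grid n \<Longrightarrow> 0 \<le> snd g"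
  by (auto simp: grid_def)

lemma finite_grid: "finite (grid n)" and card_grid: "card (grid n) = n\<^sup>2"
  by (auto simp: grid_def power2_eq_square)

lemma vec_measurable: "(\<lambda>\<omega>. \<lambda>k\<in>grid n. X k \<omega>) \<in> measurable M (leb n)"
  by (rule measurable_restrict) (use X_measurable grid_nonneg in auto)

lemma prob_space_D: "prob_space D"
  using prob_space_distr[of F lborel] F_distributed by (simp add: distributed_def)

lemma f_measurable: "f \<in> borel_measurable lborel"
  using distributed_real_measurable[OF _ F_distributed] f_nonneg by simp

lemma \<mu>_props:
  shows prob_space_\<mu>: "prob_space (\<mu> n)"
    and sets_\<mu>: "sets (\<mu> n) = sets (leb n)"
    and ac_\<mu>: "absolutely_continuous (leb n) (\<mu> n)"
  using prob_space_distr[OF vec_measurable] ac finite_grid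
  by (auto simp: joint_law_def abs_cont_process_def)

text \<open>Each coordinate is \<open>F\<close> composed with a map that preserves \<open>M\<close>,
  so it has the law of \<open>F\<close>.\<close>

lemma marginal_\<mu>:
  assumes i: "i \<in> grid n"
  shows "distr (\<mu> n) lborel (\<lambda>x. x i) = D"
proof -
  have "distr (\<mu> n) lborel (\<lambda>x. x i) = distr M lborel ((\<lambda>x. x i) \<circ> (\<lambda>\<omega>. \<lambda>k\<in>grid n. X k \<omega>))"
    unfolding joint_law_def
    by (rule distr_distr[OF measurable_component_singleton[OF i] vec_measurable])
  also have "(\<lambda>x. x i) \<circ> (\<lambda>\<omega>. \<lambda>k\<in>grid n. X k \<omega>) = F \<circ> shift i"
    using i grid_nonneg[OF i] by (auto simp: fun_eq_iff X_eq_shift)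
  also have "distr M lborel (F \<circ> shift i) = distr (distr M M (shift i)) lborel F"
    by (rule distr_distr[symmetric]) auto
  also have "\<dots> = D" using F_distributed by (simp add: distr_shift distributed_def)
  finally show ?thesis .
qed

lemma neg_xlnx: "(\<integral>\<^sup>+ t. ennreal (- (f t * ln (f t))) \<partial>lborel) < \<infinity>"
  by (rule nn_integral_neg_xlnx_density[OF f_nonneg F_distributed prob_space_axioms F_sq])

lemma ex_density_pair:
  "\<exists>\<phi>. density_pair (\<pi> n) \<phi> \<and> \<mu> n = density (\<pi> n) (\<lambda>x. ennreal (\<phi> x))"
  by (rule ex_density_pair_PiM[OF lborel.sigma_finite_measure_axioms finite_grid f_measurable
        f_nonneg prob_space_D neg_xlnx prob_space_\<mu> sets_\<mu> ac_\<mu> marginal_\<mu>])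

lemma diff_entropy_\<mu>:
  "diff_entropy (leb n) (\<mu> n) =
    - (rel_entropy (\<pi> n) (\<mu> n) + ereal (real (n\<^sup>2)) * ext_integral lborel (\<lambda>t. f t * ln (f t)))"
  using diff_entropy_eq_rel_entropy[OF lborel.sigma_finite_measure_axioms finite_grid f_measurable
        f_nonneg prob_space_D neg_xlnx prob_space_\<mu> sets_\<mu> ac_\<mu> marginal_\<mu>]
  by (simp add: card_grid)

lemma rel_entropy_nonneg: "0 \<le> rel_entropy (\<pi> n) (\<mu> n)"
  using ex_density_pair[of n] density_pair.rel_entropy_eq_kl by fastforce

lemma rel_entropy_superadditive:
  assumes m: "1 \<le> m"
  shows "ereal (real ((n div m)\<^sup>2)) * rel_entropy (\<pi> m) (\<mu> m) \<le> rel_entropy (\<pi> n) (\<mu> n)"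
proof -
  obtain \<phi> where \<phi>: "density_pair (\<pi> m) \<phi>" "\<mu> m = density (\<pi> m) (\<lambda>x. ennreal (\<phi> x))"
    using ex_density_pair by blast
  obtain \<phi>' where \<phi>': "density_pair (\<pi> n) \<phi>'" "\<mu> n = density (\<pi> n) (\<lambda>x. ennreal (\<phi>' x))"
    using ex_density_pair by blast
  \<comment> \<open>\<open>B\<close> indexes the tiles of side \<open>m\<close> that fit into the
    square of side \<open>n\<close>; \<open>h b\<close> is the corner of a tile and
    \<open>\<sigma> b\<close> the translation onto it.\<close>
  define B where "B = {..<n div m} \<times> {..<n div m}"
  define h where "h b = (int m * int (fst b), int m * int (snd b))" for b :: "nat \<times> nat"
  define \<sigma> where "\<sigma> b g = g + h b" for b g
  have h_nonneg: "0 \<le> fst (h b)" "0 \<le> snd (h b)" for b by (auto simp: h_def)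
  have in_grid: "\<sigma> b g \<in> grid n" if "b \<in> B" "g \<in> grid m" for b g
  proof -
    have "i + int m * int u < int n" if "i < int m" "u < n div m" for i u
    proof -
      have "i + int m * int u < int m * int (u + 1)" using that by (simp add: algebra_simps)
      also have "\<dots> \<le> int m * int (n div m)" using that by (intro mult_left_mono) auto
      also have "\<dots> \<le> int n" by (metis of_nat_mult of_nat_mono times_div_less_eq_dividend)
      finally show ?thesis .
    qed
    with that show ?thesis by (auto simp: \<sigma>_def grid_def B_def h_def)
  qed
  \<comment> \<open>Integer division of the coordinates of a site by \<open>m\<close> recovers the
    index of its tile.\<close>
  have disj: "disjoint_family_on (\<lambda>b. \<sigma> b ` grid m) B"
  proof -
    have div_eq: "(i + int m * int u) div int m = int u" if "0 \<le> i" "i < int m" for i u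
      using that m by (simp add: div_pos_pos_trivial)
    have inj: "b = b'" if "g \<in> grid m" "g' \<in> grid m" "\<sigma> b g = \<sigma> b' g'" for b b' g g'
    proof -
      have "fst (\<sigma> b g) div int m = int (fst b)" "snd (\<sigma> b g) div int m = int (snd b)"
        if "g \<in> grid m" for b g
        using that div_eq by (auto simp: \<sigma>_def h_def grid_def)
      from this[OF that(1), of b] this[OF that(2), of b'] that(3) show ?thesis
        by (simp add: prod_eq_iff)
    qed
    show ?thesis
      unfolding disjoint_family_on_def
    proof (intro ballI impI equals0I)
      fix b b' y assume "b \<noteq> b'" "y \<in> \<sigma> b ` grid m \<inter> \<sigma> b' ` grid m"
      then show False using inj by (elim IntE imageE) metis
    qed
  qed
  define \<tau> where "\<tau> b x = (\<lambda>g\<in>grid m. x (\<sigma> b g) :: real)" for b x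
  have indep: "prob_space.indep_vars (\<pi> n) (\<lambda>_. \<pi> m) \<tau> B"
    using indep_vars_PiM_blocks[OF prob_space_D _ disj, of "grid n"] in_grid
    by (auto simp: \<tau>_def[abs_def])
  have distr_\<pi>: "distr (\<pi> n) (\<pi> m) (\<tau> b) = \<pi> m" if "b \<in> B" for b
    unfolding \<tau>_def
    by (rule distr_PiM_reindex) (use prob_space_D in_grid that in \<open>auto simp: \<sigma>_def inj_on_def\<close>)
  have \<tau>_leb: "\<tau> b \<in> measurable (leb n) (leb m)" if "b \<in> B" for b
    unfolding \<tau>_def using in_grid[OF that]
    by (intro measurable_restrict measurable_component_singleton) auto
  have distr_\<mu>: "distr (\<mu> n) (\<pi> m) (\<tau> b) = \<mu> m" if b: "b \<in> B" for b
  proof -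
    \<comment> \<open>Only the sigma-algebra of the target matters for a push-forward, and
      \<open>\<pi> m\<close> shares it with \<open>leb m\<close>.\<close>
    have "distr (\<mu> n) (\<pi> m) (\<tau> b) = distr (\<mu> n) (leb m) (\<tau> b)"
      by (rule distr_cong) (auto intro!: sets_PiM_cong)
    also have "\<dots> = distr M (leb m) (\<tau> b \<circ> (\<lambda>\<omega>. \<lambda>k\<in>grid n. X k \<omega>))"
      unfolding joint_law_def by (rule distr_distr[OF \<tau>_leb[OF b] vec_measurable])
    \<comment> \<open>Stationarity: reading the field on a translated tile is reading it on the tile
      at the origin after applying \<open>shift (h b)\<close>, which preserves
      \<open>M\<close>.\<close>
    also have "\<dots> = distr M (leb m) ((\<lambda>\<omega>. \<lambda>k\<in>grid m. X k \<omega>) \<circ> shift (h b))"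
    proof (rule distr_cong[OF refl refl])
      fix \<omega> assume "\<omega> \<in> space M"
      then show "(\<tau> b \<circ> (\<lambda>\<omega>. \<lambda>k\<in>grid n. X k \<omega>)) \<omega> = ((\<lambda>\<omega>. \<lambda>k\<in>grid m. X k \<omega>) \<circ> shift (h b)) \<omega>"
        using in_grid[OF b] X_add[OF grid_nonneg h_nonneg]
        by (auto simp: \<tau>_def \<sigma>_def fun_eq_iff)
    qed
    also have "\<dots> = distr (distr M M (shift (h b))) (leb m) (\<lambda>\<omega>. \<lambda>k\<in>grid m. X k \<omega>)"
      by (rule distr_distr[symmetric, OF vec_measurable shift_measurable])
    finally show ?thesis by (simp add: distr_shift joint_law_def)
  qed
  have "ereal (real (card B)) * rel_entropy (\<pi> m) (\<mu> m) \<le> rel_entropy (\<pi> n) (\<mu> n)"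
    using rel_entropy_indep_blocks[OF \<phi>(1) \<phi>'(1) _ indep distr_\<pi>] distr_\<mu>
    by (simp add: B_def flip: \<phi>(2) \<phi>'(2))
  then show ?thesis by (simp add: B_def power2_eq_square)
qed

theorem entropy_rate:
  "(\<lambda>n. diff_entropy (leb n) (\<mu> n) / ereal ((real n)\<^sup>2))
    \<longlonglongrightarrow> - (SUP n\<in>{1..}. rel_entropy (\<pi> n) (\<mu> n) / ereal ((real n)\<^sup>2))
        - ext_integral lborel (\<lambda>t. f t * ln (f t))"
proof -
  define K where "K n = rel_entropy (\<pi> n) (\<mu> n)" for n
  define s where "s = (SUP n\<in>{1..}. K n / ereal ((real n)\<^sup>2))"
  define e where "e = ext_integral lborel (\<lambda>t. f t * ln (f t))"
  have K_nonneg: "0 \<le> K n" for n unfolding K_def by (rule rel_entropy_nonneg)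
  have e: "e \<noteq> - \<infinity>" unfolding e_def by (rule ext_integral_neq_MInf[OF neg_xlnx])
  have lim: "(\<lambda>n. K n / ereal ((real n)\<^sup>2)) \<longlonglongrightarrow> s"
    unfolding s_def K_def
    by (intro tendsto_SUP_of_square_superadditive rel_entropy_nonneg rel_entropy_superadditive)
  have "0 \<le> K 1 / ereal ((real 1)\<^sup>2)" using K_nonneg[of 1] by simp
  also have "\<dots> \<le> s" unfolding s_def by (rule SUP_upper) auto
  finally have s: "0 \<le> s" .
  \<comment> \<open>Both \<open>s\<close> and \<open>e\<close> differ from minus infinity, so the
    sum is never of the form infinity minus infinity and addition is continuous there.\<close>
  have "(\<lambda>n. K n / ereal ((real n)\<^sup>2) + e) \<longlonglongrightarrow> s + e"
    by (rule tendsto_add_ereal_general[OF _ lim tendsto_const]) (use e s in auto)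
  then have "(\<lambda>n. - (K n / ereal ((real n)\<^sup>2) + e)) \<longlonglongrightarrow> - (s + e)"
    by (rule tendsto_uminus_ereal)
  moreover have "\<forall>\<^sub>F n in sequentially. - (K n / ereal ((real n)\<^sup>2) + e)
      = diff_entropy (leb n) (\<mu> n) / ereal ((real n)\<^sup>2)"
  proof (rule eventually_sequentiallyI[of 1])
    fix n :: nat assume "1 \<le> n"
    then have "0 < (real n)\<^sup>2" by simp
    then show "- (K n / ereal ((real n)\<^sup>2) + e) = diff_entropy (leb n) (\<mu> n) / ereal ((real n)\<^sup>2)"
      using e K_nonneg[of n] unfolding diff_entropy_\<mu> K_def[symmetric] e_def[symmetric] of_nat_power
      by (cases "K n"; cases e) (auto simp: add_divide_distrib diff_divide_distrib)
  qed
  ultimately have "(\<lambda>n. diff_entropy (leb n) (\<mu> n) / ereal ((real n)\<^sup>2)) \<longlonglongrightarrow> - (s + e)"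
    by (rule Lim_transform_eventually)
  moreover have "- (s + e) = - s - e"
    using e s by (cases s; cases e) auto
  ultimately show ?thesis by (simp only: s_def e_def K_def)
qed

end

theorem lemma4p10:
  fixes M :: "'a measure" and T S :: "'a \<Rightarrow> 'a" and F :: "'a \<Rightarrow> real" and f :: "real \<Rightarrow> real"
    and \<mu> \<pi> :: "nat \<Rightarrow> (int \<times> int \<Rightarrow> real) measure"
  assumes "prob_space M"
    and "invertible_mpt M T" and "invertible_mpt M S"
    and "\<And>x. x \<in> space M \<Longrightarrow> T (S x) = S (T x)"
    and "F \<in> borel_measurable M" and "integrable M (\<lambda>x. (F x)\<^sup>2)"
    and "abs_cont_process M (orbit_process M T S F)"
    and "\<And>t. 0 \<le> f t" and "distributed M lborel F (\<lambda>t. ennreal (f t))"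
  defines "\<mu> \<equiv> \<lambda>n. joint_law M (orbit_process M T S F) (grid n)"
    and "\<pi> \<equiv> \<lambda>n. PiM (grid n) (\<lambda>_. density lborel (\<lambda>t. ennreal (f t)))"
  shows "(\<lambda>n. diff_entropy (PiM (grid n) (\<lambda>_. lborel)) (\<mu> n) / ereal ((real n)\<^sup>2))
    \<longlonglongrightarrow> - (SUP n\<in>{1..}. rel_entropy (\<pi> n) (\<mu> n) / ereal ((real n)\<^sup>2))
        - ext_integral lborel (\<lambda>t. f t * ln (f t))"
proof -
  interpret stationary_field M T S F f
    by (intro stationary_field.intro stationary_field_axioms.intro assms)
  show ?thesis unfolding \<mu>_def \<pi>_def by (rule entropy_rate)
qed

end
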